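(* Let $k\geq 1$ be an integer and let $\boldsymbol{S}\subset\mathbb{Z}^2$ be a finite set of integer lattice points whose elements are pairwise $k$-visible to each other, with $N=\#\boldsymbol{S}\le 2^{k+1}$. Then for real $x\geq 2$, $$N^2_k(\boldsymbol{S},x)=N^1_k(\boldsymbol{S},x)+x^2\,\frac{N}{2^{k+1}}\Bigl(1-\frac{1}{2^{k+1}}\Bigr)\prod_{p>2\text{ prime}}\Bigl(1-\frac{N}{p^{k+1}}\Bigr)+E_2(x),$$ where $$E_2(x)=\begin{cases} O_k(x\log^N x), & \text{if } 1\le N\le k,\\ O_{k,\varepsilon}\bigl(x^{2-\frac{2k}{N+k}+\varepsilon}\bigr) \text{ for every } \varepsilon>0, & \text{if } k<N\le 2^{k+1}.\end{cases}$$
   Context: $\mathbb{N}$ denotes the positive integers. For a positive integer $k$ and integer lattice points $(u,v),(m,n)$ with $m\neq u$, let $r\in\mathbb{Q}$ be given by $n-v=r(m-u)^k$ and let $\mathcal{C}$ be the curve $y-v=r(x-u)^k$. The point $(m,n)$ is called ($k$-)visible, or Level-1 $k$-visible, to $(u,v)$ if there is no integer lattice point on the segment of $\mathcal{C}$ strictly between $(u,v)$ and $(m,n)$ (i.e. no integer point $(x,y)$ on $\mathcal{C}$ with $x$ strictly between $u$ and $m$), and Level-2 $k$-visible to $(u,v)$ if there is at most one such integer lattice point; the curve is only defined when $m\neq u$, and pairs with $m=u$ are not regarded as visible. These relations are symmetric. For a set $\boldsymbol{S}$ of lattice points, $\boldsymbol{V}_k^1(\boldsymbol{S})$ (resp.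 $\boldsymbol{V}_k^2(\boldsymbol{S})$) is the set of $(m,n)\in\mathbb{N}\times\mathbb{N}$ that are Level-1 (resp. Level-2) $k$-visible to every point of $\boldsymbol{S}$, and $N^i_k(\boldsymbol{S},x)=\#\{(m,n)\in\boldsymbol{V}_k^i(\boldsymbol{S}): m,n\le x\}$ for $i=1,2$. The notation $f=O_\rho(g)$ means $|f|\le Cg$ with $C$ depending only on the parameters $\rho$.
   Formalization: A constant depending only on k (and ε) for all S and all x ≥ 2 is impossible (Chinese remainder theorem, N = 1); proved instead: such a constant for x ≥ 2 with S inside [-x,x]², and for each S a bound of the same order for all x ≥ 2 with a constant that may depend on S. *)

theory Defs
  imports "HOL-Analysis.Analysis" "HOL-Computational_Algebra.Primes"
begin

definition curve_coeff :: "nat \<Rightarrow> int \<times> int \<Rightarrow> int \<times> int \<Rightarrow> rat" where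
  "curve_coeff k P Q = of_int (snd Q - snd P) / of_int (fst Q - fst P) ^ k"

definition points_between :: "nat \<Rightarrow> int \<times> int \<Rightarrow> int \<times> int \<Rightarrow> (int \<times> int) set" where
  "points_between k P Q =
     {(x, y). min (fst P) (fst Q) < x \<and> x < max (fst P) (fst Q) \<and>
        of_int (y - snd P) = curve_coeff k P Q * of_int (x - fst P) ^ k}"

definition visible1 :: "nat \<Rightarrow> int \<times> int \<Rightarrow> int \<times> int \<Rightarrow> bool" where
  "visible1 k P Q \<longleftrightarrow> fst Q \<noteq> fst P \<and> points_between k P Q = {}"

definition visible2 :: "nat \<Rightarrow> int \<times> int \<Rightarrow> int \<times> int \<Rightarrow> bool" where
  "visible2 k P Q \<longleftrightarrow> fst Q \<noteq> fst P \<and> card (points_between k P Q) \<le> 1"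

text \<open>The abscissa determines the point on the curve, so the cardinality in
  \<^const>\<open>visible2\<close> is that of a finite set.\<close>

lemma finite_points_between: "finite (points_between k P Q)"
proof (rule finite_imageD)
  show "finite (fst ` points_between k P Q)"
    by (rule finite_subset[of _ "{min (fst P) (fst Q)..max (fst P) (fst Q)}"])
      (auto simp: points_between_def)
  show "inj_on fst (points_between k P Q)"
  proof (rule inj_onI)
    fix A B
    assume "A \<in> points_between k P Q" "B \<in> points_between k P Q" "fst A = fst B"
    then have "(of_int (snd A - snd P) :: rat) = of_int (snd B - snd P)"
      by (auto simp: points_between_def)
    then have "snd A = snd B" by simp
    with \<open>fst A = fst B\<close> show "A = B" by (simp add: prod_eq_iff)
  qed
qed

definition V1 :: "nat \<Rightarrow> (int \<times> int) set \<Rightarrow> (int \<times> int) set" where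
  "V1 k S = {Q. 1 \<le> fst Q \<and> 1 \<le> snd Q \<and> (\<forall>P\<in>S. visible1 k P Q)}"

definition V2 :: "nat \<Rightarrow> (int \<times> int) set \<Rightarrow> (int \<times> int) set" where
  "V2 k S = {Q. 1 \<le> fst Q \<and> 1 \<le> snd Q \<and> (\<forall>P\<in>S. visible2 k P Q)}"

definition N1 :: "nat \<Rightarrow> (int \<times> int) set \<Rightarrow> real \<Rightarrow> nat" where
  "N1 k S x = card {Q \<in> V1 k S. of_int (fst Q) \<le> x \<and> of_int (snd Q) \<le> x}"

definition N2 :: "nat \<Rightarrow> (int \<times> int) set \<Rightarrow> real \<Rightarrow> nat" where
  "N2 k S x = card {Q \<in> V2 k S. of_int (fst Q) \<le> x \<and> of_int (snd Q) \<le> x}"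

definition odd_prime_product :: "nat \<Rightarrow> nat \<Rightarrow> real" where
  "odd_prime_product k N =
     (\<Prod>p. if prime p \<and> p > 2 then 1 - real N / real p ^ (k + 1) else 1)"

definition E2 :: "nat \<Rightarrow> (int \<times> int) set \<Rightarrow> real \<Rightarrow> real" where
  "E2 k S x = real (N2 k S x) -
     (real (N1 k S x) +
      x\<^sup>2 * (real (card S) / 2 ^ (k + 1)) * (1 - 1 / 2 ^ (k + 1)) * odd_prime_product k (card S))"

text \<open>An error bound \<open>E2 k S x = O(g x)\<close> for \<open>x \<ge> 2\<close>. The constant \<open>C\<close>, to be chosen before
  \<open>S\<close>, serves all \<open>x\<close> with \<open>S \<subseteq> [-x, x]\<^sup>2\<close>; for the remaining, bounded range of \<open>x \<ge> 2\<close> the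
  constant has to depend on \<open>S\<close>: by the Chinese remainder theorem there is, for every \<open>X\<close>,
  a point \<open>(u, v)\<close> and distinct odd primes \<open>p m n\<close> with \<open>p m n\<close> dividing \<open>m - u\<close> and
  \<open>(p m n)^k\<close> dividing \<open>n - v\<close> for all \<open>1 \<le> m, n \<le> X\<close>, so that no point of \<open>[1, X]\<^sup>2\<close> is
  even Level-2 visible to \<open>(u, v)\<close>, and \<open>E2 k {(u, v)} X\<close> has order \<open>X\<^sup>2\<close>.\<close>

definition E2_bound :: "nat \<Rightarrow> (int \<times> int) set \<Rightarrow> real \<Rightarrow> (real \<Rightarrow> real) \<Rightarrow> bool" where
  "E2_bound k S C g \<longleftrightarrow>
     (\<forall>x\<ge>2. (\<forall>P\<in>S. \<bar>of_int (fst P)\<bar> \<le> x \<and> \<bar>of_int (snd P)\<bar> \<le> x) \<longrightarrow> \<bar>E2 k S x\<bar> \<le> C * g x) \<and>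
     (\<exists>C'. \<forall>x\<ge>2. \<bar>E2 k S x\<bar> \<le> C' * g x)"

end

theory Submission
  imports Defs
begin

text \<open>
  Write \<open>(d, a)\<close> for the difference of two lattice points. If \<open>g\<close> is the largest integer with
  \<open>g\<close> dividing \<open>d\<close> and \<open>g^k\<close> dividing \<open>a\<close>, then exactly \<open>g - 1\<close> lattice points lie between them. Hence
  Level-1 visibility forbids every prime, while Level-2 visibility forbids only the odd primes and \<open>4\<close>.
  As the points of \<open>S\<close> are pairwise visible, they are distinct modulo \<open>(p, p^k)\<close> for every prime \<open>p\<close>;
  so a point counted by \<open>N2\<close> but not by \<open>N1\<close> is hit by \<open>2\<close> (and not by \<open>4\<close>) from exactly one point of
  \<open>S\<close>, and by no odd prime. These points are counted by Legendre's sieve over sets \<open>U\<close> of odd primes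
  with \<open>\<Prod>U \<le> z\<close>, the residue classes being counted by the Chinese remainder theorem. A prime set that
  hits a point has product at most \<open>(2 * x) powr (N / k)\<close>, so for \<open>N \<le> k\<close> the choice \<open>z = 2 * x\<close> makes the
  sieve exact. For \<open>N > k\<close> one takes \<open>z = x powr (2 * N / (N + k))\<close>: if the product exceeds \<open>z\<close>, then
  some point of \<open>S\<close> contributes a factor above \<open>x powr (2 / (N + k))\<close>, which is rare.
\<close>

section \<open>Visibility and divisibility\<close>

text \<open>For \<open>g \<ge> 1\<close> this says that the curve from \<open>P\<close> to
  \<open>Q\<close> meets a lattice point at every \<open>g\<close>-th part of the difference of
  abscissas.\<close>

definition hit :: "nat \<Rightarrow> nat \<Rightarrow> int \<times> int \<Rightarrow> int \<times> int \<Rightarrow> bool" where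
  "hit k g P Q \<longleftrightarrow> int g dvd fst Q - fst P \<and> int g ^ k dvd snd Q - snd P"

lemma hit_dvd: "hit k g P Q \<Longrightarrow> h dvd g \<Longrightarrow> hit k h P Q"
  unfolding hit_def by (meson dvd_trans dvd_power_same int_dvd_int_iff)

lemma mem_points_between:
  assumes "fst Q \<noteq> fst P"
  shows "(x, y) \<in> points_between k P Q \<longleftrightarrow>
    min (fst P) (fst Q) < x \<and> x < max (fst P) (fst Q) \<and>
    (y - snd P) * (fst Q - fst P) ^ k = (snd Q - snd P) * (x - fst P) ^ k"
proof -
  have nz: "(of_int (fst Q - fst P) :: rat) ^ k \<noteq> 0" using assms by simp
  have "(of_int (y - snd P) = curve_coeff k P Q * of_int (x - fst P) ^ k) \<longleftrightarrow>
    (of_int (y - snd P) * of_int (fst Q - fst P) ^ k :: rat) =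
      of_int (snd Q - snd P) * of_int (x - fst P) ^ k"
    unfolding curve_coeff_def times_divide_eq_left using nonzero_eq_divide_eq[OF nz] by simp
  also have "\<dots> \<longleftrightarrow> (of_int ((y - snd P) * (fst Q - fst P) ^ k) :: rat) =
      of_int ((snd Q - snd P) * (x - fst P) ^ k)"
    by simp
  also have "\<dots> \<longleftrightarrow> (y - snd P) * (fst Q - fst P) ^ k = (snd Q - snd P) * (x - fst P) ^ k"
    by (rule of_int_eq_iff)
  finally show ?thesis by (simp add: points_between_def)
qed

text \<open>If the differences are \<open>g * e\<close> and \<open>g ^ k * b\<close>, the points
  \<open>P + (j * e, j ^ k * b)\<close> with \<open>0 < j < g\<close> lie on the curve, since the
  common factor \<open>g ^ k\<close> cancels from its equation.\<close>

lemma hit_imp_card_points_between: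
  assumes "fst Q \<noteq> fst P" "hit k g P Q"
  shows "g - 1 \<le> card (points_between k P Q)"
proof -
  obtain e where e: "fst Q - fst P = int g * e" using assms(2) by (auto simp: hit_def)
  obtain b where b: "snd Q - snd P = int g ^ k * b" using assms(2) by (auto simp: hit_def)
  have e0: "e \<noteq> 0" using e assms(1) by auto
  define f where "f j = (fst P + int j * e, snd P + int j ^ k * b)" for j
  have "f j \<in> points_between k P Q" if j: "j \<in> {1..<g}" for j
  proof -
    have "min (fst P) (fst Q) < fst P + int j * e \<and> fst P + int j * e < max (fst P) (fst Q)"
    proof (cases "e > 0")
      case True
      then have "0 < int j * e" "int j * e < int g * e" using j by auto
      then show ?thesis using e by (simp add: min_def max_def)
    next
      case False
      then have "e < 0" using e0 by simp
      then have "int j * e < 0" "int g * e < int j * e"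
        using j by (auto simp: mult_pos_neg)
      then show ?thesis using e by (simp add: min_def max_def)
    qed
    then show ?thesis unfolding f_def mem_points_between[OF assms(1)] e b
      by (simp add: power_mult_distrib)
  qed
  moreover have "inj_on f {1..<g}" using e0 by (auto simp: inj_on_def f_def)
  ultimately have "card {1..<g} \<le> card (points_between k P Q)"
    by (intro card_inj_on_le[of f] finite_points_between) auto
  then show ?thesis by simp
qed

text \<open>Write the relative position of the point in lowest terms as \<open>t' / d'\<close>. The
  ordinate is integral only if \<open>d' ^ k\<close> divides \<open>snd Q - snd P\<close>, because
  \<open>t'\<close> is coprime to \<open>d'\<close>; hence the denominator hits. The pair
  \<open>j\<close>, \<open>g\<close> records the position of the point.\<close>

lemma points_between_imp_hit:
  assumes "fst Q \<noteq> fst P" "(x, y) \<in> points_between k P Q"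
  obtains g j e where "2 \<le> g" "hit k g P Q" "0 < j" "j < int g" "fst Q - fst P = int g * e"
    "x - fst P = j * e"
proof -
  define d t where "d = fst Q - fst P" and "t = x - fst P"
  have d0: "d \<noteq> 0" using assms by (simp add: d_def)
  have pb: "min (fst P) (fst Q) < x" "x < max (fst P) (fst Q)"
    and eq: "(y - snd P) * d ^ k = (snd Q - snd P) * t ^ k"
    using assms mem_points_between by (auto simp: d_def t_def)
  have bt: "(0 < t \<and> t < d) \<or> (d < t \<and> t < 0)"
    using pb by (auto simp: d_def t_def min_def max_def split: if_splits)
  have "gcd t d \<noteq> 0" using d0 by simp
  then obtain t' d' where td: "t = t' * gcd t d" "d = d' * gcd t d" and cop: "coprime t' d'"
    using gcd_coprime_exists by blast
  define h where "h = gcd t d"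
  have h0: "h > 0" using d0 by (simp add: h_def)
  have td: "t = t' * h" "d = d' * h" using td by (simp_all add: h_def)
  have bt': "(0 < t' \<and> t' < d') \<or> (d' < t' \<and> t' < 0)"
    using bt h0 unfolding td by (auto simp: zero_less_mult_iff mult_less_0_iff)
  have "(y - snd P) * d' ^ k = (snd Q - snd P) * t' ^ k"
    using eq h0 unfolding td by (auto simp: power_mult_distrib)
  then have "d' ^ k dvd (snd Q - snd P) * t' ^ k" by (metis dvd_triv_right)
  then have dv: "d' ^ k dvd snd Q - snd P"
    using cop by (simp add: coprime_dvd_mult_left_iff coprime_commute)
  have "\<bar>d'\<bar> ^ k dvd snd Q - snd P" using dv by (simp flip: power_abs)
  moreover have "\<bar>d'\<bar> dvd fst Q - fst P" using td by (simp flip: d_def)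
  ultimately have "hit k (nat \<bar>d'\<bar>) P Q" by (simp add: hit_def)
  \<comment> \<open>The sign of \<open>d'\<close> is moved into the common factor, so that
    \<open>g\<close> and \<open>j\<close> come out positive.\<close>
  then show thesis
    using that[of "nat \<bar>d'\<bar>" "\<bar>t'\<bar>" "sgn d' * h"] bt' td
    by (auto simp: d_def t_def sgn_if)
qed

lemma visible1_iff:
  "visible1 k P Q \<longleftrightarrow> fst Q \<noteq> fst P \<and> (\<forall>g\<ge>2. \<not> hit k g P Q)"
proof -
  have "points_between k P Q = {} \<longleftrightarrow> (\<forall>g\<ge>2. \<not> hit k g P Q)" if ne: "fst Q \<noteq> fst P"
  proof
    assume "points_between k P Q = {}"
    then have "g - 1 \<le> 0" if "hit k g P Q" for g
      using hit_imp_card_points_between[OF ne that] by simp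
    then show "\<forall>g\<ge>2. \<not> hit k g P Q" by force
  next
    assume "\<forall>g\<ge>2. \<not> hit k g P Q"
    then show "points_between k P Q = {}"
      using points_between_imp_hit[OF ne] by (metis ex_in_conv surj_pair)
  qed
  then show ?thesis unfolding visible1_def by blast
qed

lemma visible2_iff:
  "visible2 k P Q \<longleftrightarrow> fst Q \<noteq> fst P \<and> (\<forall>g\<ge>3. \<not> hit k g P Q)"
proof -
  have "card (points_between k P Q) \<le> 1 \<longleftrightarrow> (\<forall>g\<ge>3. \<not> hit k g P Q)" if ne: "fst Q \<noteq> fst P"
  proof
    assume "card (points_between k P Q) \<le> 1"
    then have "g - 1 \<le> 1" if "hit k g P Q" for g
      using hit_imp_card_points_between[OF ne that] by simp
    then show "\<forall>g\<ge>3. \<not> hit k g P Q" by force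
  next
    assume nohit: "\<forall>g\<ge>3. \<not> hit k g P Q"
    \<comment> \<open>With no hit above \<open>2\<close>, every point in between has
      \<open>g = 2\<close> and \<open>j = 1\<close>. It therefore has the middle abscissa, which
      determines it.\<close>
    have mid: "2 * (x - fst P) = fst Q - fst P" if xy: "(x, y) \<in> points_between k P Q" for x y
    proof -
      obtain g j e where *: "2 \<le> g" "hit k g P Q" "0 < j" "j < int g"
        "fst Q - fst P = int g * e" "x - fst P = j * e"
        using points_between_imp_hit[OF ne xy] by metis
      then have "g = 2" using nohit by (metis One_nat_def Suc_1 Suc_leI le_neq_implies_less numeral_3_eq_3)
      then show ?thesis using * by simp
    qed
    have "A = B" if AB: "A \<in> points_between k P Q" "B \<in> points_between k P Q" for A B
    proof -
      have "fst A = fst B" using mid[of "fst A" "snd A"] mid[of "fst B" "snd B"] AB by auto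
      moreover from this have "(of_int (snd A - snd P) :: rat) = of_int (snd B - snd P)"
        using AB by (auto simp: points_between_def)
      ultimately show ?thesis by (simp add: prod_eq_iff)
    qed
    then show "card (points_between k P Q) \<le> 1"
      using card_le_Suc0_iff_eq[OF finite_points_between] by (metis One_nat_def)
  qed
  then show ?thesis unfolding visible2_def by blast
qed

section \<open>Reduction of visibility to prime divisors\<close>

lemma visible1_iff_primes:
  "visible1 k P Q \<longleftrightarrow> fst Q \<noteq> fst P \<and> (\<forall>p. prime p \<longrightarrow> \<not> hit k p P Q)"
  unfolding visible1_iff
  by (metis hit_dvd prime_factor_nat prime_ge_2_nat Suc_1 not_less_eq_eq le_refl)

text \<open>Without odd prime factors \<open>g\<close> is a power of \<open>2\<close>, and the
  powers of \<open>2\<close> from \<open>3\<close> on are divisible by \<open>4\<close>.\<close>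

lemma four_or_odd_prime_dvd:
  fixes g :: nat
  assumes "g \<ge> 3"
  obtains "4 dvd g" | p where "prime p" "p > 2" "p dvd g"
proof (cases "\<exists>p. prime p \<and> p > 2 \<and> p dvd g")
  case False
  have "g \<noteq> 1" using assms by simp
  then obtain p where "prime p" "p dvd g" using prime_factor_nat by blast
  then have "2 dvd g" using False prime_ge_2_nat[of p] by (metis le_neq_implies_less)
  then obtain h where h: "g = 2 * h" by blast
  then have "h \<noteq> 1" using assms by auto
  then obtain p where "prime p" "p dvd h" using prime_factor_nat by blast
  then have "p = 2" using False h prime_ge_2_nat[of p] by (metis dvd_mult le_neq_implies_less)
  then have "4 dvd g" using h \<open>p dvd h\<close> by (auto elim!: dvdE)
  then show ?thesis using that by blast
qed (use that in blast)

lemma visible2_iff_primes: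
  "visible2 k P Q \<longleftrightarrow>
    fst Q \<noteq> fst P \<and> \<not> hit k 4 P Q \<and> (\<forall>p. prime p \<and> p > 2 \<longrightarrow> \<not> hit k p P Q)"
proof -
  have "\<not> hit k g P Q"
    if "\<not> hit k 4 P Q" "\<forall>p. prime p \<and> p > 2 \<longrightarrow> \<not> hit k p P Q" "g \<ge> 3" for g
    using four_or_odd_prime_dvd[OF that(3)] that hit_dvd by metis
  then show ?thesis unfolding visible2_iff by auto
qed

text \<open>Subtracting the two divisibilities gives a hit by \<open>g\<close> between
  \<open>P\<close> and \<open>P'\<close>. This is what makes the residue classes belonging to
  different points of \<open>S\<close> disjoint.\<close>

lemma visible1_hit_unique:
  assumes "visible1 k P P'" "hit k g P Q" "hit k g P' Q"
  shows "g \<le> 1"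
proof -
  have "int g dvd (fst Q - fst P) - (fst Q - fst P')"
       "int g ^ k dvd (snd Q - snd P) - (snd Q - snd P')"
    using assms unfolding hit_def by (blast intro: dvd_diff)+
  then have "hit k g P P'" by (simp add: hit_def)
  then show ?thesis using assms(1) unfolding visible1_iff by (cases "g \<ge> 2") auto
qed

section \<open>Residue classes and tails of series\<close>

lemma crt_two_dvd:
  fixes a b c d :: int
  assumes "coprime a b"
  obtains r where "\<And>m. a dvd m - c \<and> b dvd m - d \<longleftrightarrow> a * b dvd m - r"
proof -
  obtain s t where st: "s * a + t * b = 1"
    using bezout_int[of a b] assms by auto
  \<comment> \<open>By the Bezout identity \<open>s * a\<close> is \<open>0\<close> modulo
    \<open>a\<close> and \<open>1\<close> modulo \<open>b\<close>, so \<open>r\<close> is congruent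
    to \<open>c\<close> and to \<open>d\<close> respectively.\<close>
  define r where "r = c + (d - c) * s * a"
  have 1: "m - c = (m - r) + a * ((d - c) * s)" for m by (simp add: r_def)
  have "r - d = (c - d) * (1 - s * a)" by (simp add: r_def algebra_simps)
  also have "1 - s * a = t * b" using st by simp
  finally have 2: "m - d = (m - r) + b * ((c - d) * t)" for m by (simp add: algebra_simps)
  have "a dvd m - c \<longleftrightarrow> a dvd m - r" "b dvd m - d \<longleftrightarrow> b dvd m - r" for m
    unfolding 1[of m] 2[of m] by (simp_all add: dvd_add_left_iff)
  then show thesis using that[of r] assms
    by (meson divides_mult dvd_mult_left dvd_mult_right)
qed

lemma crt_dvd:
  fixes f c :: "'a \<Rightarrow> int"
  assumes "finite I" "\<And>i j. i \<in> I \<Longrightarrow> j \<in> I \<Longrightarrow> i \<noteq> j \<Longrightarrow> coprime (f i) (f j)"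
  shows "\<exists>r. \<forall>m. (\<forall>i\<in>I. f i dvd m - c i) \<longleftrightarrow> prod f I dvd m - r"
  using assms
proof (induction I rule: finite_induct)
  case empty
  then show ?case by simp
next
  case (insert i I)
  then obtain r where r: "\<And>m. (\<forall>i\<in>I. f i dvd m - c i) \<longleftrightarrow> prod f I dvd m - r" by auto
  have "coprime (f i) (prod f I)" using insert by (intro prod_coprime_right) auto
  from crt_two_dvd[OF this, of "c i" r] obtain s
    where "\<And>m. f i dvd m - c i \<and> prod f I dvd m - r \<longleftrightarrow> f i * prod f I dvd m - s" by blast
  then show ?case using insert r by (intro exI[of _ s]) simp
qed

text \<open>The elements are \<open>a + L * j\<close> with \<open>j\<close> in an interval of length
  \<open>x / L\<close>, open below and closed above, so the count is a difference of two
  floors.\<close>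

lemma card_residue_class:
  fixes x :: real
  assumes "L \<ge> 1" "x \<ge> 0"
  shows "finite {m. 1 \<le> m \<and> of_int m \<le> x \<and> int L dvd m - a}" (is "finite ?M")
    and "\<bar>real (card {m. 1 \<le> m \<and> of_int m \<le> x \<and> int L dvd m - a}) - x / real L\<bar> \<le> 1"
proof -
  have L: "real L > 0" using assms by simp
  let ?J = "{\<lfloor>- of_int a / real L\<rfloor> + 1..\<lfloor>(x - of_int a) / real L\<rfloor>}"
  have M: "?M = (\<lambda>j. a + int L * j) ` ?J"
  proof (rule set_eqI)
    fix m
    have "m \<in> ?M \<longleftrightarrow> (\<exists>j. m = a + int L * j \<and> 1 \<le> m \<and> of_int m \<le> x)"
      by (auto simp: dvd_def algebra_simps)
    also have "\<dots> \<longleftrightarrow> (\<exists>j. m = a + int L * j \<and> j \<in> ?J)"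
    proof (intro ex_cong1 conj_cong refl)
      fix j assume m: "m = a + int L * j"
      \<comment> \<open>The strict form of the lower bound makes the interval of \<open>j\<close>
        half-open; this keeps the error at most \<open>1\<close>.\<close>
      have "1 \<le> m \<longleftrightarrow> 0 < real_of_int m" by linarith
      also have "\<dots> \<longleftrightarrow> - of_int a / real L < of_int j" using L m by (simp add: field_simps) linarith
      also have "\<dots> \<longleftrightarrow> \<lfloor>- of_int a / real L\<rfloor> + 1 \<le> j" by (simp add: add1_zle_eq floor_less_iff)
      finally have 1: "1 \<le> m \<longleftrightarrow> \<lfloor>- of_int a / real L\<rfloor> + 1 \<le> j" .
      have "of_int m \<le> x \<longleftrightarrow> of_int j \<le> (x - of_int a) / real L" using L m by (simp add: field_simps)
      also have "\<dots> \<longleftrightarrow> j \<le> \<lfloor>(x - of_int a) / real L\<rfloor>" by (simp add: le_floor_iff)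
      finally show "1 \<le> m \<and> of_int m \<le> x \<longleftrightarrow> j \<in> ?J" using 1 by simp
    qed
    also have "\<dots> \<longleftrightarrow> m \<in> (\<lambda>j. a + int L * j) ` ?J" by blast
    finally show "m \<in> ?M \<longleftrightarrow> m \<in> (\<lambda>j. a + int L * j) ` ?J" .
  qed
  then show "finite ?M" by simp
  have "inj_on (\<lambda>j. a + int L * j) ?J" using assms by (auto simp: inj_on_def)
  then have "card ?M = card ?J" unfolding M by (rule card_image)
  also have "\<dots> = nat (\<lfloor>(x - of_int a) / real L\<rfloor> - \<lfloor>- of_int a / real L\<rfloor>)" by simp
  finally have c: "card ?M = nat (\<lfloor>(x - of_int a) / real L\<rfloor> - \<lfloor>- of_int a / real L\<rfloor>)" .
  have "\<lfloor>- of_int a / real L\<rfloor> \<le> \<lfloor>(x - of_int a) / real L\<rfloor>"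
    using assms by (intro floor_mono divide_right_mono) auto
  then have "real (card ?M) = of_int \<lfloor>(x - of_int a) / real L\<rfloor> - of_int \<lfloor>- of_int a / real L\<rfloor>"
    unfolding c by simp
  moreover have "(x - of_int a) / real L - (- of_int a / real L) = x / real L"
    by (simp add: diff_divide_distrib)
  ultimately show "\<bar>real (card ?M) - x / real L\<bar> \<le> 1" by linarith
qed

text \<open>\<open>E\<close> will be the set of abscissas or of ordinates of \<open>S\<close>, whose
  removal changes the count by at most \<open>N\<close>.\<close>

lemma card_residue_class_diff:
  fixes x :: real
  assumes "L \<ge> 1" "x \<ge> 0" "finite E" "card E \<le> N"
  shows "\<bar>real (card {m. 1 \<le> m \<and> of_int m \<le> x \<and> m \<notin> E \<and> int L dvd m - a}) - x / real L\<bar>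
    \<le> real N + 1"
proof -
  let ?M = "{m. 1 \<le> m \<and> of_int m \<le> x \<and> int L dvd m - a}"
  have eq: "{m. 1 \<le> m \<and> of_int m \<le> x \<and> m \<notin> E \<and> int L dvd m - a} = ?M - E" by auto
  have "card (?M - E) \<le> card ?M" "card ?M - card E \<le> card (?M - E)"
    using card_residue_class(1)[OF assms(1,2)] assms(3)
    by (auto intro: card_mono diff_card_le_card_Diff)
  then show ?thesis unfolding eq using card_residue_class(2)[OF assms(1,2), of a] assms(4)
    by linarith
qed

section \<open>Tails of convergent series\<close>

text \<open>\<open>G\<close> plays the part of the tail integral of \<open>h\<close>: extending
  \<open>A\<close> to a full interval above \<open>n0\<close> lets the differences of
  \<open>G\<close> telescope.\<close>

lemma sum_telescope_tail:
  fixes h G :: "nat \<Rightarrow> real"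
  assumes "finite A" "\<And>n. n \<in> A \<Longrightarrow> n > n0" "\<And>n. n > n0 \<Longrightarrow> h n \<le> G (n - 1) - G n"
    "\<And>n. n > n0 \<Longrightarrow> 0 \<le> h n" "\<And>n. G n \<ge> 0"
  shows "sum h A \<le> G n0"
proof -
  have *: "sum h {n0<..n0 + m} \<le> G n0 - G (n0 + m)" for m
  proof (induction m)
    case (Suc m)
    have "{n0<..n0 + Suc m} = insert (n0 + Suc m) {n0<..n0 + m}" by auto
    then show ?case using Suc assms(3)[of "n0 + Suc m"] by simp
  qed simp
  have "sum h A \<le> sum h {n0<..n0 + Max (insert 0 A)}"
    using assms(1,2,4) by (intro sum_mono2) (auto simp: trans_le_add2)
  also have "\<dots> \<le> G n0" using *[of "Max (insert 0 A)"] assms(5)[of "n0 + Max (insert 0 A)"] by linarith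
  finally show ?thesis .
qed

lemma sum_inverse_squares_tail:
  fixes z :: real
  assumes "finite A" "\<And>n. n \<in> A \<Longrightarrow> real n > z" "z \<ge> 1"
  shows "(\<Sum>n\<in>A. 1 / real n ^ 2) \<le> 2 / z"
proof -
  define n0 where "n0 = nat \<lfloor>z\<rfloor>"
  have n0: "n0 \<ge> 1" "real n0 \<le> z" "z < real n0 + 1" using assms(3) unfolding n0_def by linarith+
  have "(\<Sum>n\<in>A. 1 / real n ^ 2) \<le> 1 / real n0"
  proof (rule sum_telescope_tail[OF assms(1)])
    fix n assume "n > n0"
    then obtain m where "n = Suc m" "m \<ge> 1" using n0 by (cases n) auto
    then have "1 / real (n - 1) - 1 / real n = 1 / (real m * real n)" by (simp add: field_simps)
    also have "\<dots> \<ge> 1 / (real n * real n)"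
      using \<open>n = Suc m\<close> \<open>m \<ge> 1\<close> by (intro divide_left_mono mult_right_mono mult_pos_pos) auto
    finally show "1 / real n ^ 2 \<le> 1 / real (n - 1) - 1 / real n" by (simp add: power2_eq_square)
  qed (use assms(2) n0 in \<open>force+\<close>)
  \<comment> \<open>Passing from \<open>z\<close> to its floor costs a factor \<open>2\<close>,
    since \<open>z < n0 + 1 \<le> 2 * n0\<close>.\<close>
  also have "\<dots> \<le> 2 / z"
  proof -
    have "1 \<le> real n0" using n0(1) by simp
    then have "z \<le> real n0 * 2" using n0 by linarith
    then have "2 / (real n0 * 2) \<le> 2 / z" using assms(3) by (intro divide_left_mono) auto
    then show ?thesis by simp
  qed
  finally show ?thesis .
qed

text \<open>Here the telescoping function is \<open>2 / sqrt n\<close>; rationalising the difference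
  of consecutive square roots shows that its decrements dominate the terms.\<close>

lemma sum_inverse_three_halves_tail:
  fixes z :: real
  assumes "finite A" "\<And>n. n \<in> A \<Longrightarrow> real n > z" "z \<ge> 1"
  shows "(\<Sum>n\<in>A. 1 / (real n * sqrt (real n))) \<le> 4 / sqrt z"
proof -
  define n0 where "n0 = nat \<lfloor>z\<rfloor>"
  have n0: "n0 \<ge> 1" "real n0 \<le> z" "z < real n0 + 1" using assms(3) unfolding n0_def by linarith+
  have "(\<Sum>n\<in>A. 1 / (real n * sqrt (real n))) \<le> 2 / sqrt (real n0)"
  proof (rule sum_telescope_tail[OF assms(1)])
    fix n assume "n > n0"
    then obtain m where nm: "n = Suc m" "m \<ge> 1" using n0 by (cases n) auto
    define a b where "a = sqrt (real m)" and "b = sqrt (real n)"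
    have ab: "0 < a" "a \<le> b" "a ^ 2 = real m" "b ^ 2 = real n" using nm by (auto simp: a_def b_def)
    have d: "(b - a) * (b + a) = 1" using ab nm by (simp add: algebra_simps power2_eq_square)
    have "1 / (b ^ 2 * b) \<le> 2 / a - 2 / b"
    proof -
      have "2 / a - 2 / b = 2 * (b - a) / (a * b)" using ab by (simp add: field_simps)
      also have "b - a = 1 / (b + a)" using d ab by (simp add: field_simps)
      also have "2 * (1 / (b + a)) / (a * b) = 2 / ((b + a) * (a * b))" by simp
      also have "\<dots> \<ge> 2 / ((b + b) * (b * b))"
        using ab by (intro divide_left_mono mult_mono mult_pos_pos) auto
      finally show ?thesis by (simp add: power2_eq_square)
    qed
    then show "1 / (real n * sqrt (real n)) \<le> 2 / sqrt (real (n - 1)) - 2 / sqrt (real n)"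
      using ab nm by (simp add: a_def b_def)
  qed (use assms(2) n0 in \<open>force+\<close>)
  also have "\<dots> \<le> 4 / sqrt z"
  proof -
    have "sqrt z \<le> sqrt (4 * real n0)" using n0 by (intro real_sqrt_le_mono) linarith
    then have "sqrt z \<le> 2 * sqrt (real n0)" by (simp add: real_sqrt_mult)
    then show ?thesis using n0 assms(3) by (simp add: field_simps)
  qed
  finally show ?thesis .
qed

section \<open>Sets of odd primes\<close>

text \<open>These sets stand for the odd squarefree integers: \<open>\<Prod>U\<close> is the
  integer, \<open>card U\<close> its number of prime factors and \<open>(-1) ^ card U\<close> its
  Moebius value.\<close>

definition odd_prime_sets :: "nat set set" where
  "odd_prime_sets = {U. finite U \<and> (\<forall>p\<in>U. prime p \<and> p > 2)}"

definition odd_prime_sets_upto :: "real \<Rightarrow> nat set set" where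
  "odd_prime_sets_upto z = {U \<in> odd_prime_sets. real (\<Prod>U) \<le> z}"

lemma odd_prime_setsD:
  assumes "U \<in> odd_prime_sets"
  shows "finite U" "p \<in> U \<Longrightarrow> prime p" "p \<in> U \<Longrightarrow> p > 2"
  using assms by (auto simp: odd_prime_sets_def)

lemma odd_prime_sets_subset: "U \<in> odd_prime_sets \<Longrightarrow> V \<subseteq> U \<Longrightarrow> V \<in> odd_prime_sets"
  by (auto simp: odd_prime_sets_def intro: finite_subset)

lemma prod_odd_prime_set_pos: "U \<in> odd_prime_sets \<Longrightarrow> \<Prod>U > 0"
  by (auto simp: odd_prime_sets_def intro!: prod_pos)

lemma odd_prime_set_eq: "U \<in> odd_prime_sets \<Longrightarrow> U = {p. prime p \<and> p dvd \<Prod>U}"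
  by (auto simp: odd_prime_sets_def prime_dvd_prod_iff) (metis primes_dvd_imp_eq)

text \<open>Unique factorisation; it allows sums over prime sets to be compared with sums over
  integers.\<close>

lemma inj_on_prod_odd_prime_sets: "inj_on \<Prod> odd_prime_sets"
  by (rule inj_onI) (metis odd_prime_set_eq)

lemma finite_odd_prime_sets_upto: "finite (odd_prime_sets_upto z)"
proof (rule finite_imageD)
  have "\<Prod> ` odd_prime_sets_upto z \<subseteq> {..nat \<lfloor>z\<rfloor>}"
    by (auto simp: odd_prime_sets_upto_def le_nat_floor)
  then show "finite (\<Prod> ` odd_prime_sets_upto z)" by (rule finite_subset) simp
  show "inj_on \<Prod> (odd_prime_sets_upto z)"
    by (rule inj_on_subset[OF inj_on_prod_odd_prime_sets]) (auto simp: odd_prime_sets_upto_def)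
qed

lemma odd_prime_sets_upto_subset:
  assumes "U \<in> odd_prime_sets_upto z" "V \<subseteq> U"
  shows "V \<in> odd_prime_sets_upto z"
proof -
  have U: "U \<in> odd_prime_sets" "real (\<Prod>U) \<le> z" using assms by (auto simp: odd_prime_sets_upto_def)
  have "\<Prod>V dvd \<Prod>U" using odd_prime_setsD[OF U(1)] assms by (intro prod_dvd_prod_subset) auto
  then have "\<Prod>V \<le> \<Prod>U" using prod_odd_prime_set_pos[OF U(1)] by (rule dvd_imp_le)
  then have "real (\<Prod>V) \<le> z" using U(2) by linarith
  then show ?thesis using odd_prime_sets_subset[OF U(1) assms(2)]
    by (simp add: odd_prime_sets_upto_def)
qed

text \<open>Induction on \<open>N\<close>: expanding \<open>(N + 1) ^ card U\<close> over the
  subsets \<open>V\<close> of \<open>U\<close> splits \<open>\<Prod>U\<close> into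
  \<open>\<Prod>V\<close> and \<open>\<Prod>(U - V)\<close>, and each step contributes one further
  harmonic sum, that is, one factor \<open>1 + ln z\<close>.\<close>

lemma sum_odd_prime_sets_upto_le:
  fixes z :: real
  assumes "z \<ge> 1"
  shows "(\<Sum>U\<in>odd_prime_sets_upto z. real N ^ card U / real (\<Prod>U)) \<le> (1 + ln z) ^ N"
proof (induction N)
  case 0
  have e: "{} \<in> odd_prime_sets_upto z"
    using assms by (simp add: odd_prime_sets_upto_def odd_prime_sets_def)
  \<comment> \<open>Only the empty set survives, because \<open>0 ^ 0 = 1\<close>.\<close>
  have "(\<Sum>U\<in>odd_prime_sets_upto z. real 0 ^ card U / real (\<Prod>U)) =
    (\<Sum>U\<in>odd_prime_sets_upto z. if U = {} then 1 else 0)"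
    by (intro sum.cong refl)
      (auto simp: odd_prime_sets_upto_def odd_prime_sets_def power_0_left)
  then show ?case using e finite_odd_prime_sets_upto by simp
next
  case (Suc N)
  let ?O = "odd_prime_sets_upto z"
  have one: "(\<Sum>W\<in>?O. 1 / real (\<Prod>W)) \<le> 1 + ln z"
  proof -
    define n where "n = nat \<lfloor>z\<rfloor>"
    have n: "n > 0" "real n \<le> z" using assms unfolding n_def by linarith+
    have "(\<Sum>W\<in>?O. 1 / real (\<Prod>W)) = (\<Sum>m\<in>\<Prod> ` ?O. 1 / real m)"
      by (subst sum.reindex[OF inj_on_subset[OF inj_on_prod_odd_prime_sets]])
        (auto simp: odd_prime_sets_upto_def)
    also have "\<dots> \<le> (\<Sum>m\<in>{1..n}. 1 / real m)"
      by (intro sum_mono2) (auto simp: odd_prime_sets_upto_def n_def le_nat_floor Suc_le_eq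
          intro!: prod_odd_prime_set_pos)
    also have "\<dots> = harm n" by (simp add: harm_def inverse_eq_divide)
    also have "\<dots> \<le> 1 + ln (real n)"
      using euler_mascheroni_sequence_decreasing[of 1 n] n by (simp add: harm_expand)
    also have "\<dots> \<le> 1 + ln z" using n by simp
    finally show ?thesis .
  qed
  have "(\<Sum>U\<in>?O. real (Suc N) ^ card U / real (\<Prod>U)) =
    (\<Sum>U\<in>?O. \<Sum>V\<in>Pow U. real N ^ card V / real (\<Prod>V) * (1 / real (\<Prod>(U - V))))"
  proof (intro sum.cong refl)
    fix U assume "U \<in> ?O"
    then have U: "U \<in> odd_prime_sets" by (simp add: odd_prime_sets_upto_def)
    have "real (Suc N) ^ card U = (\<Prod>p\<in>U. real N + 1)" by (simp add: add.commute)
    also have "\<dots> = (\<Sum>V\<in>Pow U. (\<Prod>p\<in>V. real N) * (\<Prod>p\<in>U - V. 1))"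
      using odd_prime_setsD(1)[OF U] by (rule prod_add)
    also have "\<dots> = (\<Sum>V\<in>Pow U. real N ^ card V)" by simp
    finally have "real (Suc N) ^ card U / real (\<Prod>U) = (\<Sum>V\<in>Pow U. real N ^ card V / real (\<Prod>U))"
      by (simp add: sum_divide_distrib)
    also have "\<dots> = (\<Sum>V\<in>Pow U. real N ^ card V / real (\<Prod>V) * (1 / real (\<Prod>(U - V))))"
    proof (intro sum.cong refl)
      fix V assume "V \<in> Pow U"
      then have "\<Prod>U = \<Prod>V * \<Prod>(U - V)"
        using prod.subset_diff[of V U "\<lambda>p. p"] odd_prime_setsD(1)[OF U] by (simp add: mult.commute)
      then show "real N ^ card V / real (\<Prod>U) = real N ^ card V / real (\<Prod>V) * (1 / real (\<Prod>(U - V)))"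
        by simp
    qed
    finally show "real (Suc N) ^ card U / real (\<Prod>U) =
      (\<Sum>V\<in>Pow U. real N ^ card V / real (\<Prod>V) * (1 / real (\<Prod>(U - V))))" .
  qed
  also have "\<dots> = (\<Sum>(U, V)\<in>Sigma ?O Pow. real N ^ card V / real (\<Prod>V) * (1 / real (\<Prod>(U - V))))"
    by (intro sum.Sigma finite_odd_prime_sets_upto ballI)
      (auto simp: odd_prime_sets_upto_def odd_prime_sets_def)
  \<comment> \<open>The pair \<open>(U, V)\<close> is sent to \<open>(V, U - V)\<close>. Admitting
    all pairs, disjoint or not, only adds nonnegative terms and makes the sum factor.\<close>
  also have "\<dots> \<le> (\<Sum>(V, W)\<in>?O \<times> ?O. real N ^ card V / real (\<Prod>V) * (1 / real (\<Prod>W)))"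
  proof (rule sum_le_included[where i = "\<lambda>(V, W). (V \<union> W, V)"])
    show "finite (Sigma ?O Pow)" using finite_odd_prime_sets_upto
      by (intro finite_SigmaI) (auto simp: odd_prime_sets_upto_def odd_prime_sets_def)
    show "\<forall>x\<in>Sigma ?O Pow. \<exists>y\<in>?O \<times> ?O. (case y of (V, W) \<Rightarrow> (V \<union> W, V)) = x \<and>
      (case x of (U, V) \<Rightarrow> real N ^ card V / real (\<Prod>V) * (1 / real (\<Prod>(U - V)))) \<le>
      (case y of (V, W) \<Rightarrow> real N ^ card V / real (\<Prod>V) * (1 / real (\<Prod>W)))"
    proof safe
      fix U V assume "U \<in> ?O" "V \<subseteq> U"
      then show "\<exists>y\<in>?O \<times> ?O. (case y of (V, W) \<Rightarrow> (V \<union> W, V)) = (U, V) \<and>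
        real N ^ card V / real (\<Prod>V) * (1 / real (\<Prod>(U - V))) \<le>
        (case y of (V, W) \<Rightarrow> real N ^ card V / real (\<Prod>V) * (1 / real (\<Prod>W)))"
        by (intro bexI[of _ "(V, U - V)"]) (auto intro: odd_prime_sets_upto_subset)
    qed
    show "\<forall>y\<in>?O \<times> ?O. 0 \<le> (case y of (V, W) \<Rightarrow> real N ^ card V / real (\<Prod>V) * (1 / real (\<Prod>W)))"
      by (auto intro!: divide_nonneg_nonneg mult_nonneg_nonneg prod_nonneg)
  qed (use finite_odd_prime_sets_upto in simp)
  also have "\<dots> = (\<Sum>V\<in>?O. real N ^ card V / real (\<Prod>V)) * (\<Sum>W\<in>?O. 1 / real (\<Prod>W))"
    by (simp add: sum_product sum.cartesian_product)
  also have "\<dots> \<le> (1 + ln z) ^ N * (1 + ln z)"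
    using Suc.IH one assms by (intro mult_mono sum_nonneg) (auto intro: prod_nonneg)
  finally show ?case by (simp add: mult.commute)
qed

text \<open>A prime \<open>p\<close> from \<open>B\<close> on satisfies
  \<open>c \<le> p powr \<delta>\<close>. Fewer than \<open>B + 1\<close> primes lie below
  \<open>B\<close>, each costing at most a factor \<open>c\<close>, so \<open>C = c ^ B\<close>
  suffices.\<close>

lemma pow_card_le_prod_powr:
  fixes c \<delta> :: real
  assumes "c \<ge> 1" "\<delta> > 0"
  obtains C where "C \<ge> 1" "\<And>U. U \<in> odd_prime_sets \<Longrightarrow> c ^ card U \<le> C * real (\<Prod>U) powr \<delta>"
proof -
  define B where "B = nat \<lceil>c powr (1 / \<delta>)\<rceil>"
  have big: "c \<le> real p powr \<delta>" if "p \<ge> B" for p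
  proof -
    have "c powr (1 / \<delta>) \<le> real p" using that unfolding B_def by linarith
    then have "(c powr (1 / \<delta>)) powr \<delta> \<le> real p powr \<delta>" using assms by (intro powr_mono2) auto
    then show ?thesis using assms by (simp add: powr_powr)
  qed
  have "c ^ card U \<le> c ^ B * real (\<Prod>U) powr \<delta>" if U: "U \<in> odd_prime_sets" for U
  proof -
    have fin: "finite U" using odd_prime_setsD[OF U] by simp
    have "c ^ card U = (\<Prod>p\<in>U. c)" by simp
    also have "\<dots> \<le> (\<Prod>p\<in>U. (if p < B then c else 1) * real p powr \<delta>)"
    proof (intro prod_mono conjI)
      fix p assume "p \<in> U"
      then have "real p powr \<delta> \<ge> 1" using odd_prime_setsD(3)[OF U, of p] assms
        by (intro ge_one_powr_ge_zero) auto
      then have "c * 1 \<le> c * real p powr \<delta>" using assms by (intro mult_left_mono) auto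
      then show "c \<le> (if p < B then c else 1) * real p powr \<delta>" using big[of p] by simp
    qed (use assms in auto)
    also have "\<dots> = c ^ card {p \<in> U. p < B} * (\<Prod>p\<in>U. real p powr \<delta>)"
      using fin by (simp add: prod.distrib prod.If_cases Int_def)
    also have "(\<Prod>p\<in>U. real p powr \<delta>) = real (\<Prod>U) powr \<delta>"
      by (simp add: prod_powr_distrib)
    also have "c ^ card {p \<in> U. p < B} \<le> c ^ B"
    proof (rule power_increasing[OF _ assms(1)])
      have "card {p \<in> U. p < B} \<le> card {..<B}" by (intro card_mono) auto
      then show "card {p \<in> U. p < B} \<le> B" by simp
    qed
    finally show ?thesis by (simp add: mult_right_mono)
  qed
  then show thesis using that[of "c ^ B"] assms by simp
qed

text \<open>A finite partial product expands into a sum over sets of primes; the sets of product at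
  most \<open>z\<close> give the stated sum and all others fall under \<open>tail\<close>. Stating
  \<open>tail\<close> for finite families avoids infinite sums over sets.\<close>

lemma odd_prime_product_approx:
  fixes z \<tau> :: real
  assumes "k \<ge> 1"
    and tail: "\<And>F. finite F \<Longrightarrow> F \<subseteq> odd_prime_sets - odd_prime_sets_upto z \<Longrightarrow>
      (\<Sum>U\<in>F. real N ^ card U / real (\<Prod>U) ^ (k + 1)) \<le> \<tau>"
  shows "\<bar>odd_prime_product k N -
    (\<Sum>U\<in>odd_prime_sets_upto z. (-1) ^ card U * (real N ^ card U / real (\<Prod>U) ^ (k + 1)))\<bar> \<le> \<tau>"
proof -
  define f where "f p = (if prime p \<and> p > 2 then 1 - real N / real p ^ (k + 1) else 1)" for p :: nat
  define w where "w U = real N ^ card U / real (\<Prod>U) ^ (k + 1)" for U :: "nat set"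
  \<comment> \<open>Convergence has to be known before the infinite product can be identified with
    the limit of its partial products; comparison with \<open>N / n ^ 2\<close> gives it.\<close>
  have "summable (\<lambda>p. norm (f p - 1))"
  proof (rule summable_comparison_test')
    show "summable (\<lambda>n. real N * (1 / real n ^ 2))"
      by (intro summable_mult) (use inverse_power_summable[of 2] in \<open>simp add: inverse_eq_divide\<close>)
    show "norm (norm (f n - 1)) \<le> real N * (1 / real n ^ 2)" if "n \<ge> 1" for n
    proof -
      have "real n ^ 2 \<le> real n ^ (k + 1)" using that assms by (intro power_increasing) auto
      then have "real N / real n ^ (k + 1) \<le> real N / real n ^ 2"
        using that by (intro divide_left_mono mult_pos_pos) auto
      then show ?thesis by (simp add: f_def)
    qed
  qed
  then have "convergent_prod f"
    by (intro abs_convergent_prod_imp_convergent_prod summable_imp_abs_convergent_prod)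
  from convergent_prod_LIMSEQ[OF this]
  have lim: "(\<lambda>Y. \<Prod>p\<le>Y. f p) \<longlonglongrightarrow> odd_prime_product k N"
    by (simp add: odd_prime_product_def f_def[abs_def])
  let ?O = "odd_prime_sets_upto z"
  \<comment> \<open>A prime in a set with product at most \<open>z\<close> is itself at most
    \<open>z\<close>, so for these \<open>Y\<close> all sets of \<open>?O\<close> occur in the
    expansion.\<close>
  have "\<bar>(\<Prod>p\<le>Y. f p) - (\<Sum>U\<in>?O. (-1) ^ card U * w U)\<bar> \<le> \<tau>" if Y: "Y \<ge> nat \<lfloor>z\<rfloor>" for Y
  proof -
    define P where "P = {p. prime p \<and> p > 2 \<and> p \<le> Y}"
    have finP: "finite P" by (rule finite_subset[of _ "{..Y}"]) (auto simp: P_def)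
    have PO: "Pow P \<subseteq> odd_prime_sets"
      using finP by (auto simp: odd_prime_sets_def P_def intro: finite_subset)
    have sub: "?O \<subseteq> Pow P"
    proof safe
      fix U p assume U: "U \<in> ?O" and p: "p \<in> U"
      then have U': "U \<in> odd_prime_sets" "real (\<Prod>U) \<le> z" by (auto simp: odd_prime_sets_upto_def)
      have "p dvd \<Prod>U" using p odd_prime_setsD(1)[OF U'(1)] by (intro dvd_prodI) auto
      then have "p \<le> \<Prod>U" using prod_odd_prime_set_pos[OF U'(1)] by (rule dvd_imp_le)
      also have "\<dots> \<le> Y" using U'(2) Y by (metis le_nat_floor order_trans)
      finally show "p \<in> P" using p odd_prime_setsD[OF U'(1)] by (simp add: P_def)
    qed
    have "(\<Prod>p\<le>Y. f p) = (\<Prod>p\<in>P. 1 - real N / real p ^ (k + 1))"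
      by (rule prod.mono_neutral_cong_right) (auto simp: P_def f_def)
    also have "\<dots> = (\<Sum>U\<in>Pow P. (-1) ^ card U * (\<Prod>p\<in>U. real N / real p ^ (k + 1)) * (\<Prod>p\<in>P - U. 1))"
      by (rule prod_diff_conv_sum[OF finP])
    also have "\<dots> = (\<Sum>U\<in>Pow P. (-1) ^ card U * w U)"
      by (simp add: w_def prod_dividef prod_power_distrib prod.distrib)
    also have "\<dots> = (\<Sum>U\<in>?O. (-1) ^ card U * w U) + (\<Sum>U\<in>Pow P - ?O. (-1) ^ card U * w U)"
      using sum.subset_diff[OF sub, of "\<lambda>U. (-1) ^ card U * w U"] finP by (simp add: add.commute)
    finally have "\<bar>(\<Prod>p\<le>Y. f p) - (\<Sum>U\<in>?O. (-1) ^ card U * w U)\<bar> =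
      \<bar>\<Sum>U\<in>Pow P - ?O. (-1) ^ card U * w U\<bar>" by simp
    also have "\<dots> \<le> (\<Sum>U\<in>Pow P - ?O. \<bar>(-1) ^ card U * w U\<bar>)" by (rule sum_abs)
    also have "\<dots> = (\<Sum>U\<in>Pow P - ?O. w U)"
      by (intro sum.cong refl) (simp add: abs_mult power_abs w_def abs_of_nonneg prod_nonneg)
    also have "\<dots> \<le> \<tau>" unfolding w_def using finP PO by (intro tail) auto
    finally show ?thesis .
  qed
  then have ev: "eventually (\<lambda>Y. \<bar>(\<Prod>p\<le>Y. f p) - (\<Sum>U\<in>?O. (-1) ^ card U * w U)\<bar> \<le> \<tau>) sequentially"
    unfolding eventually_sequentially by blast
  have "(\<lambda>Y. \<bar>(\<Prod>p\<le>Y. f p) - (\<Sum>U\<in>?O. (-1) ^ card U * w U)\<bar>)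
    \<longlonglongrightarrow> \<bar>odd_prime_product k N - (\<Sum>U\<in>?O. (-1) ^ card U * w U)\<bar>"
    by (intro tendsto_intros lim)
  from tendsto_upperbound[OF this ev] show ?thesis by (simp add: w_def)
qed

section \<open>The sieve\<close>

lemma finite_ints_upto: "finite {m. 1 \<le> m \<and> real_of_int m \<le> x}"
  by (rule finite_subset[of _ "{1..\<lfloor>x\<rfloor>}"]) (auto simp: le_floor_iff)

lemma card_ints_upto:
  assumes "x \<ge> 0"
  shows "real (card {m. 1 \<le> m \<and> real_of_int m \<le> x}) \<le> x"
proof -
  have "{m. 1 \<le> m \<and> real_of_int m \<le> x} = {1..\<lfloor>x\<rfloor>}" by (auto simp: le_floor_iff)
  then show ?thesis using assms by simp
qed

text \<open>One set \<open>S\<close> at one height \<open>x\<close>. The assumption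
  \<open>box\<close> keeps all coordinate differences between \<open>S\<close> and the points
  counted below \<open>2 * x\<close>, uniformly in \<open>S\<close>.\<close>

locale visible_set =
  fixes k :: nat and S :: "(int \<times> int) set" and x :: real
  assumes k_pos: "k \<ge> 1" and finite_S: "finite S" and vis: "pairwise (visible1 k) S"
    and x_ge: "x \<ge> 2"
    and box: "\<And>P. P \<in> S \<Longrightarrow> \<bar>real_of_int (fst P)\<bar> \<le> x \<and> \<bar>real_of_int (snd P)\<bar> \<le> x"
begin

abbreviation N :: nat where "N \<equiv> card S"

text \<open>Points sharing a coordinate with \<open>S\<close> are removed, so that a hit \<open>g\<close> satisfies
  \<open>g ^ k \<le> 2 * x\<close>; this costs only \<open>O(x)\<close> points.\<close>

definition grid :: "(int \<times> int) set" where
  "grid = {m. 1 \<le> m \<and> of_int m \<le> x \<and> m \<notin> fst ` S} \<times> {n. 1 \<le> n \<and> of_int n \<le> x \<and> n \<notin> snd ` S}"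

definition hit_primes :: "int \<times> int \<Rightarrow> nat set" where
  "hit_primes Q = {p. prime p \<and> p > 2 \<and> (\<exists>P\<in>S. hit k p P Q)}"

definition sifted :: "nat \<Rightarrow> int \<times> int \<Rightarrow> (int \<times> int) set" where
  "sifted q P = {Q \<in> grid. hit k q P Q \<and> hit_primes Q = {}}"

text \<open>Bounds the error of truncating the sieve at \<open>z\<close>: a point whose hit primes
  have product above \<open>z\<close> may be miscounted by as much as the number of subsets of its
  hit primes.\<close>

definition sieve_tail :: "real \<Rightarrow> real" where
  "sieve_tail z = (\<Sum>Q | Q \<in> grid \<and> real (\<Prod>(hit_primes Q)) > z. 2 ^ card (hit_primes Q))"

lemma finite_grid: "finite grid"
  unfolding grid_def
  by (intro finite_cartesian_product; rule finite_subset[OF _ finite_ints_upto]) auto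

lemma grid_diff:
  assumes "Q \<in> grid" "P \<in> S"
  shows "fst Q \<noteq> fst P" "snd Q \<noteq> snd P"
    "\<bar>real_of_int (fst Q - fst P)\<bar> \<le> 2 * x" "\<bar>real_of_int (snd Q - snd P)\<bar> \<le> 2 * x"
proof -
  show "fst Q \<noteq> fst P" "snd Q \<noteq> snd P" using assms by (auto simp: grid_def)
  have "real_of_int (fst Q) \<ge> 1" "real_of_int (snd Q) \<ge> 1" "real_of_int (fst Q) \<le> x"
    "real_of_int (snd Q) \<le> x" using assms by (auto simp: grid_def)
  then show "\<bar>real_of_int (fst Q - fst P)\<bar> \<le> 2 * x" "\<bar>real_of_int (snd Q - snd P)\<bar> \<le> 2 * x"
    using box[OF assms(2)] by auto
qed

text \<open>Both coordinate differences are nonzero on \<open>grid\<close>, so a divisor is bounded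
  by their size.\<close>

lemma hit_bounds:
  assumes "Q \<in> grid" "P \<in> S" "hit k g P Q"
  shows "real g \<le> 2 * x" "real g ^ k \<le> 2 * x"
proof -
  have "int g \<le> \<bar>fst Q - fst P\<bar>" "int g ^ k \<le> \<bar>snd Q - snd P\<bar>"
    using assms grid_diff(1,2)[OF assms(1,2)] dvd_imp_le_int unfolding hit_def
    by (metis abs_of_nat right_minus_eq of_nat_power)+
  then have "real_of_int (int g) \<le> real_of_int \<bar>fst Q - fst P\<bar>"
    "real_of_int (int g ^ k) \<le> real_of_int \<bar>snd Q - snd P\<bar>"
    by (simp_all only: of_int_le_iff)
  then show "real g \<le> 2 * x" "real g ^ k \<le> 2 * x"
    using grid_diff(3,4)[OF assms(1,2)] by simp_all
qed

lemma hit_unique: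
  assumes "P \<in> S" "P' \<in> S" "hit k g P Q" "hit k g P' Q" "g \<ge> 2"
  shows "P = P'"
proof (rule ccontr)
  assume "P \<noteq> P'"
  then have "visible1 k P P'" using vis assms by (auto simp: pairwise_def)
  from visible1_hit_unique[OF this assms(3,4)] show False using assms(5) by simp
qed

lemma hit_primes_in: "Q \<in> grid \<Longrightarrow> hit_primes Q \<in> odd_prime_sets"
proof -
  assume "Q \<in> grid"
  then have "hit_primes Q \<subseteq> {..nat \<lfloor>2 * x\<rfloor>}"
    using hit_bounds(1)[of Q] unfolding hit_primes_def by (blast intro: le_nat_floor)
  then have "finite (hit_primes Q)" by (rule finite_subset) simp
  then show ?thesis by (auto simp: odd_prime_sets_def hit_primes_def)
qed

section \<open>Counting points with prescribed hits\<close>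

text \<open>The Chinese remainder theorem merges all conditions into one class modulo
  \<open>L = q * \<Prod>U\<close> for the abscissa and one modulo \<open>L ^ k\<close> for the
  ordinate, so the count is a product of two interval counts.\<close>

lemma card_simultaneous_hits:
  assumes U: "U \<in> odd_prime_sets" and q: "q \<ge> 1" "\<And>p. p \<in> U \<Longrightarrow> coprime p q"
  shows "\<bar>real (card {Q \<in> grid. hit k q P Q \<and> (\<forall>p\<in>U. hit k p (\<phi> p) Q)}) -
      x\<^sup>2 / real (q * \<Prod>U) ^ (k + 1)\<bar>
    \<le> 2 * (real N + 1) * x / real (\<Prod>U) + (real N + 1)\<^sup>2"
proof -
  define D L where "D = \<Prod>U" and "L = q * D"
  have D: "D > 0" using prod_odd_prime_set_pos[OF U] by (simp add: D_def)
  have DL: "D \<le> L" "L \<ge> 1" using q D by (simp_all add: L_def Suc_le_eq)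
  have cop: "coprime p p'" if "p \<in> U" "p' \<in> U" "p \<noteq> p'" for p p'
    using odd_prime_setsD(2)[OF U] that by (intro primes_coprime) auto
  have qD: "coprime (int q) (int D)"
    using q(2) unfolding D_def of_nat_prod by (intro prod_coprime_right) (auto simp: coprime_commute)
  obtain r0 where r0: "\<And>m. (\<forall>p\<in>U. int p dvd m - fst (\<phi> p)) \<longleftrightarrow> int D dvd m - r0"
    using crt_dvd[OF odd_prime_setsD(1)[OF U], of int "\<lambda>p. fst (\<phi> p)"] cop unfolding D_def by auto
  obtain r where r: "\<And>m. int q dvd m - fst P \<and> int D dvd m - r0 \<longleftrightarrow> int q * int D dvd m - r"
    using crt_two_dvd[OF qD, of "fst P" r0] by blast
  have pk: "(\<Prod>p\<in>U. int p ^ k) = int D ^ k" by (simp add: D_def prod_power_distrib)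
  obtain s0 where s0: "\<And>m. (\<forall>p\<in>U. int p ^ k dvd m - snd (\<phi> p)) \<longleftrightarrow> int D ^ k dvd m - s0"
    using crt_dvd[OF odd_prime_setsD(1)[OF U], of "\<lambda>p. int p ^ k" "\<lambda>p. snd (\<phi> p)"] cop
    unfolding pk by auto
  have "coprime (int q ^ k) (int D ^ k)" using qD by simp
  from crt_two_dvd[OF this, of "snd P" s0]
  obtain s where s: "\<And>m. int q ^ k dvd m - snd P \<and> int D ^ k dvd m - s0
      \<longleftrightarrow> int q ^ k * int D ^ k dvd m - s" by blast
  let ?A = "{m. 1 \<le> m \<and> of_int m \<le> x \<and> m \<notin> fst ` S \<and> int L dvd m - r}"
  let ?B = "{n. 1 \<le> n \<and> of_int n \<le> x \<and> n \<notin> snd ` S \<and> int (L ^ k) dvd n - s}"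
  have "hit k q P Q \<and> (\<forall>p\<in>U. hit k p (\<phi> p) Q) \<longleftrightarrow>
     int L dvd fst Q - r \<and> int (L ^ k) dvd snd Q - s" for Q
    using r[of "fst Q"] s[of "snd Q"] unfolding r0[symmetric] s0[symmetric] hit_def L_def
    by (auto simp: power_mult_distrib)
  then have "{Q \<in> grid. hit k q P Q \<and> (\<forall>p\<in>U. hit k p (\<phi> p) Q)} = ?A \<times> ?B"
    by (auto simp: grid_def)
  then have c: "real (card {Q \<in> grid. hit k q P Q \<and> (\<forall>p\<in>U. hit k p (\<phi> p) Q)}) =
      real (card ?A) * real (card ?B)" by (simp add: card_cartesian_product)
  define \<alpha> \<beta> a b n where "\<alpha> = real (card ?A)" and "\<beta> = real (card ?B)" and "a = x / real L"
    and "b = x / real (L ^ k)" and "n = real N + 1"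
  have "L ^ k \<ge> 1" using DL by simp
  have n: "\<bar>\<alpha> - a\<bar> \<le> n" "\<bar>\<beta> - b\<bar> \<le> n"
    unfolding \<alpha>_def \<beta>_def a_def b_def n_def
    using x_ge finite_S DL(2) \<open>L ^ k \<ge> 1\<close>
    by (intro card_residue_class_diff card_image_le finite_imageI; simp)+
  \<comment> \<open>As \<open>k \<ge> 1\<close>, the ordinate modulus is at least \<open>D\<close>
    as well, and both densities are at most \<open>x / D\<close>.\<close>
  have "L ^ 1 \<le> L ^ k" using DL k_pos by (intro power_increasing) auto
  then have "real D \<le> real (L ^ k)" using DL by (simp only: power_one_right of_nat_le_iff)
  then have ab: "0 \<le> a" "a \<le> x / real D" "0 \<le> b" "b \<le> x / real D"
    using x_ge DL D unfolding a_def b_def by (auto intro!: divide_left_mono mult_pos_pos)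
  \<comment> \<open>The product of two approximations: one product of errors and two cross
    terms.\<close>
  have "\<alpha> * \<beta> - a * b = (\<alpha> - a) * (\<beta> - b) + a * (\<beta> - b) + b * (\<alpha> - a)"
    by (simp add: algebra_simps)
  then have "\<bar>\<alpha> * \<beta> - a * b\<bar> \<le> \<bar>\<alpha> - a\<bar> * \<bar>\<beta> - b\<bar> + a * \<bar>\<beta> - b\<bar> + b * \<bar>\<alpha> - a\<bar>"
    using ab abs_triangle_ineq[of "(\<alpha> - a) * (\<beta> - b) + a * (\<beta> - b)" "b * (\<alpha> - a)"]
      abs_triangle_ineq[of "(\<alpha> - a) * (\<beta> - b)" "a * (\<beta> - b)"]
    by (simp add: abs_mult)
  also have "\<dots> \<le> n * n + x / real D * n + x / real D * n"
    using n ab x_ge by (intro add_mono mult_mono) auto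
  finally have "\<bar>\<alpha> * \<beta> - a * b\<bar> \<le> 2 * n * x / real D + n\<^sup>2" by (simp add: power2_eq_square)
  moreover have "a * b = x\<^sup>2 / real L ^ (k + 1)" by (simp add: a_def b_def power2_eq_square)
  ultimately show ?thesis unfolding c by (simp only: \<alpha>_def \<beta>_def n_def L_def D_def)
qed

text \<open>If all primes of \<open>U\<close> hit \<open>Q\<close>, then by
  \<open>hit_unique\<close> exactly one map \<open>\<phi>\<close> from \<open>U\<close> to
  \<open>S\<close> tells from where. The set is thus a disjoint union over \<open>N ^ card U\<close>
  such maps.\<close>

lemma card_hit_primes_superset:
  assumes U: "U \<in> odd_prime_sets" and q: "q \<ge> 1" "\<And>p. p \<in> U \<Longrightarrow> coprime p q"
  shows "\<bar>real (card {Q \<in> grid. hit k q P Q \<and> U \<subseteq> hit_primes Q}) -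
      real N ^ card U * (x\<^sup>2 / real (q * \<Prod>U) ^ (k + 1))\<bar>
    \<le> real N ^ card U * (2 * (real N + 1) * x / real (\<Prod>U) + (real N + 1)\<^sup>2)"
proof -
  have fin: "finite U" using odd_prime_setsD[OF U] by simp
  define \<Phi> where "\<Phi> = (\<Pi>\<^sub>E p\<in>U. S)"
  define H where "H \<phi> = {Q \<in> grid. hit k q P Q \<and> (\<forall>p\<in>U. hit k p (\<phi> p) Q)}" for \<phi>
  have fin\<Phi>: "finite \<Phi>" unfolding \<Phi>_def using fin finite_S by (intro finite_PiE) auto
  have card\<Phi>: "real (card \<Phi>) = real N ^ card U" unfolding \<Phi>_def using fin by (simp add: card_PiE)
  have "{Q \<in> grid. hit k q P Q \<and> U \<subseteq> hit_primes Q} = (\<Union>\<phi>\<in>\<Phi>. H \<phi>)"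
  proof (rule set_eqI, rule iffI)
    fix Q assume Q: "Q \<in> {Q \<in> grid. hit k q P Q \<and> U \<subseteq> hit_primes Q}"
    then have "\<forall>p\<in>U. \<exists>P'\<in>S. hit k p P' Q" by (auto simp: hit_primes_def)
    then obtain \<psi> where \<psi>: "\<forall>p\<in>U. \<psi> p \<in> S \<and> hit k p (\<psi> p) Q" by metis
    then have "restrict \<psi> U \<in> \<Phi>" "Q \<in> H (restrict \<psi> U)" using Q by (auto simp: \<Phi>_def H_def)
    then show "Q \<in> (\<Union>\<phi>\<in>\<Phi>. H \<phi>)" by blast
  next
    fix Q assume "Q \<in> (\<Union>\<phi>\<in>\<Phi>. H \<phi>)"
    then show "Q \<in> {Q \<in> grid. hit k q P Q \<and> U \<subseteq> hit_primes Q}"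
      using odd_prime_setsD[OF U] by (auto simp: H_def \<Phi>_def hit_primes_def)
  qed
  moreover have "card (\<Union>\<phi>\<in>\<Phi>. H \<phi>) = (\<Sum>\<phi>\<in>\<Phi>. card (H \<phi>))"
  proof (rule card_UN_disjoint[OF fin\<Phi>])
    show "\<forall>\<phi>\<in>\<Phi>. finite (H \<phi>)" unfolding H_def using finite_grid by auto
    show "\<forall>\<phi>\<in>\<Phi>. \<forall>\<psi>\<in>\<Phi>. \<phi> \<noteq> \<psi> \<longrightarrow> H \<phi> \<inter> H \<psi> = {}"
    proof (intro ballI impI equals0I)
      fix \<phi> \<psi> Q assume *: "\<phi> \<in> \<Phi>" "\<psi> \<in> \<Phi>" "\<phi> \<noteq> \<psi>" "Q \<in> H \<phi> \<inter> H \<psi>"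
      have "\<phi> p = \<psi> p" if "p \<in> U" for p
        using * that odd_prime_setsD(3)[OF U that]
        by (intro hit_unique[of _ _ p Q]) (auto simp: \<Phi>_def H_def)
      then have "\<phi> = \<psi>" using *(1,2) unfolding \<Phi>_def by (rule PiE_ext[rotated 2]) auto
      then show False using *(3) by simp
    qed
  qed
  ultimately have "real (card {Q \<in> grid. hit k q P Q \<and> U \<subseteq> hit_primes Q}) = (\<Sum>\<phi>\<in>\<Phi>. real (card (H \<phi>)))"
    by simp
  then have "\<bar>real (card {Q \<in> grid. hit k q P Q \<and> U \<subseteq> hit_primes Q}) -
      real N ^ card U * (x\<^sup>2 / real (q * \<Prod>U) ^ (k + 1))\<bar> =
      \<bar>\<Sum>\<phi>\<in>\<Phi>. real (card (H \<phi>)) - x\<^sup>2 / real (q * \<Prod>U) ^ (k + 1)\<bar>"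
    by (simp only: sum_subtractf sum_constant card\<Phi>)
  also have "\<dots> \<le> (\<Sum>\<phi>\<in>\<Phi>. \<bar>real (card (H \<phi>)) - x\<^sup>2 / real (q * \<Prod>U) ^ (k + 1)\<bar>)" by (rule sum_abs)
  also have "\<dots> \<le> (\<Sum>\<phi>\<in>\<Phi>. 2 * (real N + 1) * x / real (\<Prod>U) + (real N + 1)\<^sup>2)"
    unfolding H_def by (intro sum_mono card_simultaneous_hits assms)
  finally show ?thesis by (simp only: sum_constant card\<Phi>)
qed

section \<open>The truncated Legendre sieve\<close>

lemma sieve_inequality:
  assumes "z \<ge> 1"
  shows "\<bar>real (card (sifted q P)) - (\<Sum>U\<in>odd_prime_sets_upto z.
      (-1) ^ card U * real (card {Q \<in> grid. hit k q P Q \<and> U \<subseteq> hit_primes Q}))\<bar> \<le> sieve_tail z"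
proof -
  let ?O = "odd_prime_sets_upto z"
  define G where "G = {Q \<in> grid. hit k q P Q}"
  define \<sigma> where "\<sigma> Q = (\<Sum>U | U \<in> ?O \<and> U \<subseteq> hit_primes Q. (-1) ^ card U :: real)" for Q
  have finG: "finite G" using finite_grid by (simp add: G_def)
  have "real (card (sifted q P)) = (\<Sum>Q\<in>G. if hit_primes Q = {} then 1 else 0)"
    using finG by (simp add: sum.If_cases sifted_def G_def Int_def conj_assoc)
  moreover have "(\<Sum>U\<in>?O. (-1) ^ card U * real (card {Q \<in> grid. hit k q P Q \<and> U \<subseteq> hit_primes Q})) =
     (\<Sum>Q\<in>G. \<sigma> Q)"
  proof -
    have "(\<Sum>U\<in>?O. (-1) ^ card U * real (card {Q \<in> grid. hit k q P Q \<and> U \<subseteq> hit_primes Q})) =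
      (\<Sum>U\<in>?O. \<Sum>Q | Q \<in> G \<and> U \<subseteq> hit_primes Q. (-1) ^ card U)"
      by (simp add: G_def conj_assoc mult.commute)
    also have "\<dots> = (\<Sum>Q\<in>G. \<sigma> Q)" unfolding \<sigma>_def
      by (rule sum.swap_restrict[OF finite_odd_prime_sets_upto finG])
    finally show ?thesis .
  qed
  ultimately have "\<bar>real (card (sifted q P)) - (\<Sum>U\<in>?O.
      (-1) ^ card U * real (card {Q \<in> grid. hit k q P Q \<and> U \<subseteq> hit_primes Q}))\<bar> =
      \<bar>\<Sum>Q\<in>G. (if hit_primes Q = {} then 1 else 0) - \<sigma> Q\<bar>" by (simp add: sum_subtractf)
  also have "\<dots> \<le> (\<Sum>Q\<in>G. \<bar>(if hit_primes Q = {} then 1 else 0) - \<sigma> Q\<bar>)" by (rule sum_abs)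
  also have "\<dots> \<le> (\<Sum>Q\<in>G. if real (\<Prod>(hit_primes Q)) > z then 2 ^ card (hit_primes Q) else 0)"
  proof (rule sum_mono)
    fix Q assume "Q \<in> G"
    then have T: "hit_primes Q \<in> odd_prime_sets" by (intro hit_primes_in) (simp add: G_def)
    then have finT: "finite (hit_primes Q)" by (rule odd_prime_setsD)
    show "\<bar>(if hit_primes Q = {} then 1 else 0) - \<sigma> Q\<bar> \<le>
      (if real (\<Prod>(hit_primes Q)) > z then 2 ^ card (hit_primes Q) else 0)"
    proof (cases "real (\<Prod>(hit_primes Q)) > z")
      \<comment> \<open>Since \<open>z \<ge> 1\<close>, the set \<open>hit_primes Q\<close> is
        nonempty here, so the indicator is \<open>0\<close> and only \<open>\<sigma> Q\<close> has
        to be bounded.\<close>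
      case True
      have "\<bar>\<sigma> Q\<bar> \<le> (\<Sum>U | U \<in> ?O \<and> U \<subseteq> hit_primes Q. \<bar>(-1) ^ card U :: real\<bar>)"
        unfolding \<sigma>_def by (rule sum_abs)
      also have "\<dots> = real (card {U. U \<in> ?O \<and> U \<subseteq> hit_primes Q})" by (simp add: power_abs)
      also have "\<dots> \<le> real (card (Pow (hit_primes Q)))"
        using finT by (intro of_nat_mono card_mono) auto
      also have "\<dots> = 2 ^ card (hit_primes Q)" using finT by (simp add: card_Pow)
      finally show ?thesis using True assms by auto
    next
      case False
      then have "hit_primes Q \<in> ?O" using T by (simp add: odd_prime_sets_upto_def)
      then have "{U. U \<in> ?O \<and> U \<subseteq> hit_primes Q} = Pow (hit_primes Q)"
        using odd_prime_sets_upto_subset by auto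
      then have "\<sigma> Q = (\<Prod>p\<in>hit_primes Q. 1 - 1)"
        unfolding \<sigma>_def prod_diff_conv_sum[OF finT] by simp
      then show ?thesis using False finT by (simp add: power_0_left)
    qed
  qed
  also have "\<dots> \<le> (\<Sum>Q\<in>grid. if real (\<Prod>(hit_primes Q)) > z then 2 ^ card (hit_primes Q) else 0)"
    using finite_grid by (intro sum_mono2) (auto simp: G_def)
  also have "\<dots> = sieve_tail z"
    using finite_grid unfolding sieve_tail_def by (simp add: sum.If_cases Int_def)
  finally show ?thesis .
qed

text \<open>Three errors are added: truncation of the sieve, replacing each count by its density,
  and replacing the truncated sum of densities by the infinite product.\<close>

lemma card_sifted_approx:
  assumes z: "z \<ge> 1" and q: "q \<ge> 1" "\<And>p. prime p \<Longrightarrow> p > 2 \<Longrightarrow> coprime p q"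
    and tail: "\<And>F. finite F \<Longrightarrow> F \<subseteq> odd_prime_sets - odd_prime_sets_upto z \<Longrightarrow>
      (\<Sum>U\<in>F. real N ^ card U / real (\<Prod>U) ^ (k + 1)) \<le> \<tau>"
  shows "\<bar>real (card (sifted q P)) - x\<^sup>2 / real q ^ (k + 1) * odd_prime_product k N\<bar>
    \<le> (real N + 1)\<^sup>2 * (2 * x + z) * (1 + ln z) ^ N + x\<^sup>2 * \<tau> + sieve_tail z"
proof -
  let ?O = "odd_prime_sets_upto z"
  define c where "c U = real (card {Q \<in> grid. hit k q P Q \<and> U \<subseteq> hit_primes Q})" for U
  define w where "w U = real N ^ card U / real (\<Prod>U) ^ (k + 1)" for U
  define A where "A = x\<^sup>2 / real q ^ (k + 1)"
  have A: "0 \<le> A" "A \<le> x\<^sup>2"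
  proof -
    have "1 \<le> real q ^ (k + 1)" using q(1) by (intro one_le_power) simp
    then show "A \<le> x\<^sup>2" unfolding A_def using divide_left_mono[of 1 "real q ^ (k + 1)" "x\<^sup>2"] by simp
  qed (simp add: A_def)
  have "\<tau> \<ge> 0" using tail[of "{}"] by simp
  have 1: "\<bar>real (card (sifted q P)) - (\<Sum>U\<in>?O. (-1) ^ card U * c U)\<bar> \<le> sieve_tail z"
    unfolding c_def by (rule sieve_inequality[OF z])
  have 2: "\<bar>odd_prime_product k N - (\<Sum>U\<in>?O. (-1) ^ card U * w U)\<bar> \<le> \<tau>"
    unfolding w_def by (rule odd_prime_product_approx[OF k_pos tail])
  have "\<bar>(\<Sum>U\<in>?O. (-1) ^ card U * c U) - A * (\<Sum>U\<in>?O. (-1) ^ card U * w U)\<bar> =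
    \<bar>\<Sum>U\<in>?O. (-1) ^ card U * (c U - A * w U)\<bar>"
    by (simp add: sum_distrib_left right_diff_distrib sum_subtractf mult_ac)
  also have "\<dots> \<le> (\<Sum>U\<in>?O. \<bar>(-1) ^ card U * (c U - A * w U)\<bar>)" by (rule sum_abs)
  also have "\<dots> = (\<Sum>U\<in>?O. \<bar>c U - A * w U\<bar>)" by (simp add: abs_mult power_abs)
  also have "\<dots> \<le> (\<Sum>U\<in>?O. real N ^ card U / real (\<Prod>U) * ((real N + 1)\<^sup>2 * (2 * x + z)))"
  proof (rule sum_mono)
    fix U assume "U \<in> ?O"
    then have U: "U \<in> odd_prime_sets" "real (\<Prod>U) \<le> z" by (auto simp: odd_prime_sets_upto_def)
    have D: "real (\<Prod>U) > 0" using prod_odd_prime_set_pos[OF U(1)] by (simp only: of_nat_0_less_iff)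
    have "A * w U = real N ^ card U * (x\<^sup>2 / real (q * \<Prod>U) ^ (k + 1))"
      by (simp add: A_def w_def power_mult_distrib mult_ac)
    then have "\<bar>c U - A * w U\<bar> \<le> real N ^ card U * (2 * (real N + 1) * x / real (\<Prod>U) + (real N + 1)\<^sup>2)"
      using card_hit_primes_superset[OF U(1) q(1), of P] odd_prime_setsD[OF U(1)] q(2)
      unfolding c_def by simp
    \<comment> \<open>Pulling out \<open>1 / \<Prod>U\<close> prepares for
      \<open>sum_odd_prime_sets_upto_le\<close>; the constant part of the error then carries
      \<open>\<Prod>U \<le> z\<close>.\<close>
    also have "\<dots> = real N ^ card U / real (\<Prod>U) * (2 * (real N + 1) * x + (real N + 1)\<^sup>2 * real (\<Prod>U))"
      using D by (simp add: field_simps)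
    also have "\<dots> \<le> real N ^ card U / real (\<Prod>U) * ((real N + 1)\<^sup>2 * (2 * x + z))"
    proof (rule mult_left_mono)
      have "(real N + 1) * 1 \<le> (real N + 1) * (real N + 1)" by (intro mult_left_mono) auto
      then have "2 * x * (real N + 1) \<le> 2 * x * (real N + 1)\<^sup>2"
        using x_ge by (intro mult_left_mono) (auto simp: power2_eq_square)
      then have "2 * (real N + 1) * x \<le> 2 * x * (real N + 1)\<^sup>2" by (simp only: mult_ac)
      moreover have "(real N + 1)\<^sup>2 * real (\<Prod>U) \<le> (real N + 1)\<^sup>2 * z"
        using U(2) by (intro mult_left_mono) auto
      ultimately have "2 * (real N + 1) * x + (real N + 1)\<^sup>2 * real (\<Prod>U) \<le>
        2 * x * (real N + 1)\<^sup>2 + (real N + 1)\<^sup>2 * z" by (rule add_mono)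
      also have "\<dots> = (real N + 1)\<^sup>2 * (2 * x + z)" unfolding distrib_left by simp
      finally show "2 * (real N + 1) * x + (real N + 1)\<^sup>2 * real (\<Prod>U) \<le> (real N + 1)\<^sup>2 * (2 * x + z)" .
    qed (use D in auto)
    finally show "\<bar>c U - A * w U\<bar> \<le> real N ^ card U / real (\<Prod>U) * ((real N + 1)\<^sup>2 * (2 * x + z))" .
  qed
  also have "\<dots> = (\<Sum>U\<in>?O. real N ^ card U / real (\<Prod>U)) * ((real N + 1)\<^sup>2 * (2 * x + z))"
    by (rule sum_distrib_right[symmetric])
  also have "\<dots> \<le> (1 + ln z) ^ N * ((real N + 1)\<^sup>2 * (2 * x + z))"
    using sum_odd_prime_sets_upto_le[OF z] x_ge z by (intro mult_right_mono) auto
  finally have 3: "\<bar>(\<Sum>U\<in>?O. (-1) ^ card U * c U) - A * (\<Sum>U\<in>?O. (-1) ^ card U * w U)\<bar>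
    \<le> (real N + 1)\<^sup>2 * (2 * x + z) * (1 + ln z) ^ N" by (simp add: mult_ac)
  have "\<bar>A * (\<Sum>U\<in>?O. (-1) ^ card U * w U) - A * odd_prime_product k N\<bar> =
    A * \<bar>odd_prime_product k N - (\<Sum>U\<in>?O. (-1) ^ card U * w U)\<bar>"
    using A by (simp flip: right_diff_distrib add: abs_mult abs_minus_commute)
  also have "\<dots> \<le> x\<^sup>2 * \<tau>" using A 2 \<open>\<tau> \<ge> 0\<close> by (intro mult_mono) auto
  finally show ?thesis using 1 3 unfolding A_def by linarith
qed

section \<open>The difference of the two counts\<close>

text \<open>On \<open>grid\<close>, the points that are Level-2 but not Level-1 visible form the
  disjoint union over \<open>P\<close> of \<open>sifted 2 P - sifted 4 P\<close>. The bound
  \<open>N * x\<close> covers the points off \<open>grid\<close>.\<close>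

lemma N2_minus_N1:
  "\<bar>real (N2 k S x) - real (N1 k S x) - (\<Sum>P\<in>S. real (card (sifted 2 P)) - real (card (sifted 4 P)))\<bar>
    \<le> real N * x"
proof -
  define B where "B = {m. 1 \<le> m \<and> real_of_int m \<le> x}"
  define W1 where "W1 = {Q \<in> V1 k S. of_int (fst Q) \<le> x \<and> of_int (snd Q) \<le> x}"
  define W2 where "W2 = {Q \<in> V2 k S. of_int (fst Q) \<le> x \<and> of_int (snd Q) \<le> x}"
  have finB: "finite B" unfolding B_def by (rule finite_ints_upto)
  have "W2 \<subseteq> B \<times> B" by (auto simp: W2_def V2_def B_def)
  then have fin2: "finite W2" using finB finite_subset by blast
  have sub: "W1 \<subseteq> W2"
    by (auto simp: W1_def W2_def V1_def V2_def visible1_iff visible2_iff)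
  have "card W1 + card (W2 - W1) = card W2"
    using fin2 sub by (metis card_Diff_subset card_mono finite_subset le_add_diff_inverse)
  then have d: "real (N2 k S x) - real (N1 k S x) = real (card (W2 - W1))"
    by (simp add: N1_def N2_def W1_def W2_def)
  have "(W2 - W1) \<inter> grid = (\<Union>P\<in>S. sifted 2 P - sifted 4 P)"
  proof (rule set_eqI)
    fix Q
    show "Q \<in> (W2 - W1) \<inter> grid \<longleftrightarrow> Q \<in> (\<Union>P\<in>S. sifted 2 P - sifted 4 P)"
    proof (cases "Q \<in> grid")
      case True
      then have Q: "1 \<le> fst Q" "1 \<le> snd Q" "of_int (fst Q) \<le> x" "of_int (snd Q) \<le> x"
        "\<And>P. P \<in> S \<Longrightarrow> fst Q \<noteq> fst P"
        using grid_diff(1)[OF True] by (simp_all add: grid_def mem_Times_iff)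
      have W2: "Q \<in> W2 \<longleftrightarrow> (\<forall>P\<in>S. \<not> hit k 4 P Q) \<and> hit_primes Q = {}"
        using Q unfolding W2_def V2_def visible2_iff_primes hit_primes_def by blast
      have "Q \<in> W1 \<longleftrightarrow> (\<forall>P\<in>S. \<forall>p. prime p \<longrightarrow> \<not> hit k p P Q)"
        using Q unfolding W1_def V1_def visible1_iff_primes by blast
      also have "\<dots> \<longleftrightarrow> (\<forall>P\<in>S. \<not> hit k 2 P Q) \<and> hit_primes Q = {}"
      proof
        assume "\<forall>P\<in>S. \<forall>p. prime p \<longrightarrow> \<not> hit k p P Q"
        then show "(\<forall>P\<in>S. \<not> hit k 2 P Q) \<and> hit_primes Q = {}"
          using two_is_prime_nat unfolding hit_primes_def by blast
      next
        assume *: "(\<forall>P\<in>S. \<not> hit k 2 P Q) \<and> hit_primes Q = {}"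
        show "\<forall>P\<in>S. \<forall>p. prime p \<longrightarrow> \<not> hit k p P Q"
        proof (intro ballI allI impI)
          fix P and p :: nat assume "P \<in> S" "prime p"
          then show "\<not> hit k p P Q"
            using * prime_ge_2_nat[of p] unfolding hit_primes_def by (cases "p = 2") auto
        qed
      qed
      finally have W1: "Q \<in> W1 \<longleftrightarrow> (\<forall>P\<in>S. \<not> hit k 2 P Q) \<and> hit_primes Q = {}" .
      \<comment> \<open>A hit by \<open>4\<close> from any point entails one by \<open>2\<close>,
        which can come only from \<open>P\<close>; so excluding \<open>4\<close> at \<open>P\<close>
        excludes it everywhere.\<close>
      have four: "\<not> hit k 4 P' Q" if "P \<in> S" "P' \<in> S" "hit k 2 P Q" "\<not> hit k 4 P Q" for P P'
      proof
        assume h4: "hit k 4 P' Q"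
        then have "hit k 2 P' Q" by (rule hit_dvd) simp
        then have "P = P'" using that hit_unique[of P P' 2 Q] by simp
        then show False using h4 that by simp
      qed
      show ?thesis using True W1 W2 four unfolding sifted_def by blast
    qed (auto simp: sifted_def)
  qed
  moreover have fins: "finite (sifted q P)" for q P using finite_grid by (simp add: sifted_def)
  moreover have "card (\<Union>P\<in>S. sifted 2 P - sifted 4 P) = (\<Sum>P\<in>S. card (sifted 2 P - sifted 4 P))"
  proof (rule card_UN_disjoint[OF finite_S])
    show "\<forall>P\<in>S. \<forall>P'\<in>S. P \<noteq> P' \<longrightarrow> (sifted 2 P - sifted 4 P) \<inter> (sifted 2 P' - sifted 4 P') = {}"
      using hit_unique[of _ _ 2] by (auto simp: sifted_def)
  qed (use fins in blast)
  moreover have "real (card (sifted 2 P - sifted 4 P)) = real (card (sifted 2 P)) - real (card (sifted 4 P))" for P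
  proof -
    have "sifted 4 P \<subseteq> sifted 2 P" using hit_dvd[of k 4 P _ 2] by (auto simp: sifted_def)
    then show ?thesis using fins card_mono[OF fins] by (simp add: card_Diff_subset of_nat_diff)
  qed
  ultimately have main: "real (card ((W2 - W1) \<inter> grid)) =
      (\<Sum>P\<in>S. real (card (sifted 2 P)) - real (card (sifted 4 P)))" by simp
  \<comment> \<open>Level-2 visibility already rules out the abscissas of \<open>S\<close>, so a
    point off \<open>grid\<close> shares an ordinate with \<open>S\<close>.\<close>
  have "(W2 - W1) - grid \<subseteq> B \<times> snd ` S"
    by (auto simp: W2_def V2_def visible2_def B_def grid_def)
  then have "card ((W2 - W1) - grid) \<le> card (B \<times> snd ` S)"
    using finB finite_S by (intro card_mono) auto
  also have "\<dots> \<le> card B * N" using finite_S by (simp add: card_cartesian_product card_image_le)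
  finally have "real (card ((W2 - W1) - grid)) \<le> real (card B * N)" by (rule of_nat_mono)
  also have "\<dots> \<le> x * real N" using card_ints_upto[of x] x_ge by (simp add: B_def mult_right_mono)
  finally have "real (card ((W2 - W1) - grid)) \<le> real N * x" by (simp add: mult.commute)
  moreover have "card (W2 - W1) = card ((W2 - W1) \<inter> grid) + card ((W2 - W1) - grid)"
    using fin2 card_Int_Diff by (metis finite_Diff)
  ultimately show ?thesis unfolding d main[symmetric] by simp
qed

lemma E2_estimate:
  assumes z: "z \<ge> 1"
    and tail: "\<And>F. finite F \<Longrightarrow> F \<subseteq> odd_prime_sets - odd_prime_sets_upto z \<Longrightarrow>
      (\<Sum>U\<in>F. real N ^ card U / real (\<Prod>U) ^ (k + 1)) \<le> \<tau>"
  shows "\<bar>E2 k S x\<bar> \<le> real N * x + 2 * real N *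
    ((real N + 1)\<^sup>2 * (2 * x + z) * (1 + ln z) ^ N + x\<^sup>2 * \<tau> + sieve_tail z)"
proof -
  define B where "B = (real N + 1)\<^sup>2 * (2 * x + z) * (1 + ln z) ^ N + x\<^sup>2 * \<tau> + sieve_tail z"
  define M where "M q = x\<^sup>2 / real q ^ (k + 1) * odd_prime_product k N" for q :: nat
  have cop: "coprime p 2" "coprime p 4" if "prime p" "p > 2" for p :: nat
  proof -
    show "coprime p 2" using that by (intro primes_coprime) auto
    then have "coprime p (2 ^ 2)" by (simp only: coprime_power_right_iff simp_thms)
    then show "coprime p 4" by simp
  qed
  have F: "\<bar>real (card (sifted q P)) - M q\<bar> \<le> B" if "q = 2 \<or> q = 4" for q P
    unfolding M_def B_def using that cop by (intro card_sifted_approx z tail) auto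
  have "\<bar>(\<Sum>P\<in>S. real (card (sifted 2 P)) - real (card (sifted 4 P))) - (\<Sum>P\<in>S. M 2 - M 4)\<bar> =
    \<bar>\<Sum>P\<in>S. (real (card (sifted 2 P)) - real (card (sifted 4 P))) - (M 2 - M 4)\<bar>"
    by (simp only: sum_subtractf)
  also have "\<dots> \<le> (\<Sum>P\<in>S. \<bar>(real (card (sifted 2 P)) - real (card (sifted 4 P))) - (M 2 - M 4)\<bar>)"
    by (rule sum_abs)
  also have "\<dots> \<le> (\<Sum>P\<in>S. 2 * B)"
  proof (rule sum_mono)
    fix P show "\<bar>(real (card (sifted 2 P)) - real (card (sifted 4 P))) - (M 2 - M 4)\<bar> \<le> 2 * B"
      using F[of 2 P] F[of 4 P] by simp
  qed
  finally have 1: "\<bar>(\<Sum>P\<in>S. real (card (sifted 2 P)) - real (card (sifted 4 P))) - real N * (M 2 - M 4)\<bar>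
    \<le> 2 * real N * B" by simp
  \<comment> \<open>This turns the densities for \<open>q = 2\<close> and \<open>q = 4\<close> into
    the factor \<open>1 - 1 / 2 ^ (k + 1)\<close> of the main term.\<close>
  have "(4::real) ^ (k + 1) = 2 ^ (k + 1) * 2 ^ (k + 1)"
    by (simp only: power_mult_distrib[symmetric]) simp
  then have "real N * (M 2 - M 4) =
    x\<^sup>2 * (real N / 2 ^ (k + 1)) * (1 - 1 / 2 ^ (k + 1)) * odd_prime_product k N"
    unfolding M_def of_nat_numeral by (simp only:) (simp add: field_simps)
  then have "E2 k S x = real (N2 k S x) - real (N1 k S x) - real N * (M 2 - M 4)"
    by (simp add: E2_def)
  then show ?thesis using 1 N2_minus_N1 unfolding B_def by linarith
qed

section \<open>Points with a large product of hit primes\<close>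

definition hit_part :: "int \<times> int \<Rightarrow> int \<times> int \<Rightarrow> nat" where
  "hit_part P Q = \<Prod>{p \<in> hit_primes Q. hit k p P Q}"

lemma hit_hit_part:
  assumes "Q \<in> grid"
  shows "hit k (hit_part P Q) P Q"
proof -
  let ?U = "{p \<in> hit_primes Q. hit k p P Q}"
  have U: "?U \<in> odd_prime_sets" using odd_prime_sets_subset[OF hit_primes_in[OF assms]] by auto
  have fin: "finite ?U" using odd_prime_setsD[OF U] by simp
  have cop: "coprime p p'" if "p \<in> ?U" "p' \<in> ?U" "p \<noteq> p'" for p p'
    using odd_prime_setsD(2)[OF U] that by (intro primes_coprime) auto
  have dvd_prod: "(\<Prod>p\<in>V. f p) dvd a" if "V \<subseteq> ?U" "\<And>p. p \<in> ?U \<Longrightarrow> f p dvd a"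
    "\<And>p p'. p \<in> ?U \<Longrightarrow> p' \<in> ?U \<Longrightarrow> p \<noteq> p' \<Longrightarrow> coprime (f p) (f p')" for f and a :: int and V
    using finite_subset[OF that(1) fin] that(1)
  proof (induction V rule: finite_induct)
    case (insert p V)
    then have "coprime (f p) (\<Prod>p\<in>V. f p)" using that(3) by (intro prod_coprime_right) blast
    then show ?case using insert that(2) by (simp add: divides_mult)
  qed simp
  have "(\<Prod>p\<in>?U. int p) dvd fst Q - fst P"
    by (rule dvd_prod) (auto simp: hit_def intro: cop)
  moreover have "(\<Prod>p\<in>?U. int p ^ k) dvd snd Q - snd P"
    by (rule dvd_prod) (auto simp: hit_def intro: cop)
  ultimately show ?thesis by (simp add: hit_def hit_part_def prod_power_distrib)
qed

text \<open>By \<open>hit_unique\<close> every hit prime belongs to exactly one point of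
  \<open>S\<close>.\<close>

lemma prod_hit_primes:
  assumes "Q \<in> grid"
  shows "\<Prod>(hit_primes Q) = (\<Prod>P\<in>S. hit_part P Q)"
proof -
  have "hit_primes Q = (\<Union>P\<in>S. {p \<in> hit_primes Q. hit k p P Q})" by (auto simp: hit_primes_def)
  then have "\<Prod>(hit_primes Q) = \<Prod>(\<Union>P\<in>S. {p \<in> hit_primes Q. hit k p P Q})" by simp
  also have "\<dots> = (\<Prod>P\<in>S. hit_part P Q)" unfolding hit_part_def
  proof (rule prod.UNION_disjoint[OF finite_S])
    show "\<forall>P\<in>S. finite {p \<in> hit_primes Q. hit k p P Q}"
      using odd_prime_setsD(1)[OF hit_primes_in[OF assms]] by simp
    show "\<forall>P\<in>S. \<forall>P'\<in>S. P \<noteq> P' \<longrightarrow>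
      {p \<in> hit_primes Q. hit k p P Q} \<inter> {p \<in> hit_primes Q. hit k p P' Q} = {}"
    proof (intro ballI impI equals0I)
      fix P P' p assume "P \<in> S" "P' \<in> S" "P \<noteq> P'"
        "p \<in> {p \<in> hit_primes Q. hit k p P Q} \<inter> {p \<in> hit_primes Q. hit k p P' Q}"
      then show False using hit_unique[of P P' p Q] by (simp add: hit_primes_def)
    qed
  qed
  finally show ?thesis .
qed

lemma hit_part_bounds:
  assumes "Q \<in> grid" "P \<in> S"
  shows "real (hit_part P Q) \<le> 2 * x" "real (hit_part P Q) ^ k \<le> 2 * x"
  using hit_bounds[OF assms hit_hit_part[OF assms(1)]] by auto

lemma prod_hit_primes_power_le:
  assumes "Q \<in> grid"
  shows "real (\<Prod>(hit_primes Q)) ^ k \<le> (2 * x) ^ N"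
proof -
  have "real (\<Prod>(hit_primes Q)) ^ k = (\<Prod>P\<in>S. real (hit_part P Q) ^ k)"
    unfolding prod_hit_primes[OF assms] by (simp add: prod_power_distrib)
  also have "\<dots> \<le> (\<Prod>P\<in>S. 2 * x)" using hit_part_bounds(2)[OF assms] by (intro prod_mono) auto
  finally show ?thesis by simp
qed

text \<open>If there is any hit at all, \<open>d\<close> and \<open>d ^ k\<close> are at most
  \<open>2 * x\<close>, so the rounding error \<open>1\<close> of each interval count is absorbed,
  at the price of a factor \<open>3\<close> per coordinate.\<close>

lemma card_hits_le:
  assumes "P \<in> S" "d \<ge> 1"
  shows "real (card {Q \<in> grid. hit k d P Q}) \<le> 9 * x\<^sup>2 / real d ^ (k + 1)"
proof (cases "{Q \<in> grid. hit k d P Q} = {}")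
  case True
  then have "card {Q \<in> grid. hit k d P Q} = 0" by (simp only: card.empty)
  then show ?thesis using x_ge by (simp only:) simp
next
  case False
  then have d: "real d \<le> 2 * x" "real d ^ k \<le> 2 * x" using hit_bounds assms(1) by blast+
  let ?A = "{m. 1 \<le> m \<and> of_int m \<le> x \<and> int d dvd m - fst P}"
  let ?B = "{m. 1 \<le> m \<and> of_int m \<le> x \<and> int (d ^ k) dvd m - snd P}"
  have dk: "1 \<le> d ^ k" using assms by simp
  have "\<bar>real (card ?A) - x / real d\<bar> \<le> 1"
    using assms x_ge by (intro card_residue_class(2)) auto
  moreover have "1 \<le> 2 * x / real d" using d assms by (simp add: field_simps)
  moreover have "3 * x / real d = 2 * x / real d + x / real d"
    by (simp add: add_divide_distrib[symmetric])
  ultimately have A: "real (card ?A) \<le> 3 * x / real d" by linarith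
  have "\<bar>real (card ?B) - x / real (d ^ k)\<bar> \<le> 1"
    using dk x_ge by (intro card_residue_class(2)) auto
  moreover have "1 \<le> 2 * x / real (d ^ k)" using d assms by (simp add: field_simps)
  moreover have "3 * x / real (d ^ k) = 2 * x / real (d ^ k) + x / real (d ^ k)"
    by (simp add: add_divide_distrib[symmetric])
  ultimately have B: "real (card ?B) \<le> 3 * x / real (d ^ k)" by linarith
  have "{Q \<in> grid. hit k d P Q} \<subseteq> ?A \<times> ?B" by (auto simp: grid_def hit_def)
  moreover have "finite ?A" "finite ?B" using assms dk x_ge
    by (intro card_residue_class(1); simp)+
  ultimately have "card {Q \<in> grid. hit k d P Q} \<le> card (?A \<times> ?B)" by (intro card_mono) auto
  then have "real (card {Q \<in> grid. hit k d P Q}) \<le> real (card ?A) * real (card ?B)"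
    unfolding card_cartesian_product of_nat_mult[symmetric] of_nat_le_iff .
  also have "\<dots> \<le> 3 * x / real d * (3 * x / real (d ^ k))" using A B x_ge by (intro mult_mono) auto
  also have "\<dots> = 9 * x\<^sup>2 / real d ^ (k + 1)" by (simp add: power2_eq_square)
  finally show ?thesis .
qed

text \<open>If a product of \<open>N\<close> parts exceeds \<open>y ^ N\<close>, some part
  \<open>d\<close> exceeds \<open>y\<close>. Summing the counts over such \<open>d\<close>, one
  bounds \<open>d ^ (k - 1)\<close> below by \<open>y ^ (k - 1)\<close> and keeps an inverse square
  tail of size \<open>2 / y\<close>.\<close>

lemma card_large_hit_primes:
  assumes "y \<ge> 1"
  shows "real (card {Q \<in> grid. real (\<Prod>(hit_primes Q)) > y ^ N}) \<le> real N * (18 * x\<^sup>2 / y ^ k)"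
proof -
  define R where "R = {d. y < real d \<and> real d \<le> 2 * x}"
  have finR: "finite R" by (rule finite_subset[of _ "{..nat \<lfloor>2 * x\<rfloor>}"]) (auto simp: R_def le_nat_floor)
  have "{Q \<in> grid. real (\<Prod>(hit_primes Q)) > y ^ N} \<subseteq> (\<Union>P\<in>S. \<Union>d\<in>R. {Q \<in> grid. hit k d P Q})"
  proof safe
    fix a b assume Q: "(a, b) \<in> grid" and gt: "y ^ N < real (\<Prod>(hit_primes (a, b)))"
    have "\<exists>P\<in>S. real (hit_part P (a, b)) > y"
    proof (rule ccontr)
      assume "\<not> ?thesis"
      then have "(\<Prod>P\<in>S. real (hit_part P (a, b))) \<le> (\<Prod>P\<in>S. y)" by (intro prod_mono) auto
      then show False using gt unfolding prod_hit_primes[OF Q] by simp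
    qed
    then obtain P where "P \<in> S" "real (hit_part P (a, b)) > y" by blast
    then show "(a, b) \<in> (\<Union>P\<in>S. \<Union>d\<in>R. {Q \<in> grid. hit k d P Q})"
      using hit_part_bounds(1)[OF Q, of P] hit_hit_part[OF Q, of P] Q by (auto simp: R_def)
  qed
  then have "card {Q \<in> grid. real (\<Prod>(hit_primes Q)) > y ^ N} \<le>
      card (\<Union>P\<in>S. \<Union>d\<in>R. {Q \<in> grid. hit k d P Q})"
    using finite_S finR finite_grid by (intro card_mono) auto
  also have "\<dots> \<le> (\<Sum>P\<in>S. card (\<Union>d\<in>R. {Q \<in> grid. hit k d P Q}))" by (rule card_UN_le[OF finite_S])
  also have "\<dots> \<le> (\<Sum>P\<in>S. \<Sum>d\<in>R. card {Q \<in> grid. hit k d P Q})"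
    by (intro sum_mono card_UN_le finR)
  finally have "real (card {Q \<in> grid. real (\<Prod>(hit_primes Q)) > y ^ N}) \<le>
    real (\<Sum>P\<in>S. \<Sum>d\<in>R. card {Q \<in> grid. hit k d P Q})" by (rule of_nat_mono)
  also have "\<dots> = (\<Sum>P\<in>S. \<Sum>d\<in>R. real (card {Q \<in> grid. hit k d P Q}))" by simp
  also have "\<dots> \<le> (\<Sum>P\<in>S. \<Sum>d\<in>R. 9 * x\<^sup>2 / y ^ (k - 1) * (1 / real d ^ 2))"
  proof (intro sum_mono)
    fix P d assume "P \<in> S" "d \<in> R"
    then have d: "d \<ge> 1" "real d > y" using assms by (auto simp: R_def Suc_le_eq intro!: gr0I)
    have "k + 1 = (k - 1) + 2" using k_pos by simp
    then have e: "real d ^ (k + 1) = real d ^ (k - 1) * real d ^ 2" by (metis power_add)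
    have "real (card {Q \<in> grid. hit k d P Q}) \<le> 9 * x\<^sup>2 / real d ^ (k + 1)"
      by (rule card_hits_le[OF \<open>P \<in> S\<close> d(1)])
    also have "\<dots> \<le> 9 * x\<^sup>2 / (y ^ (k - 1) * real d ^ 2)" unfolding e
      using d assms by (intro divide_left_mono mult_right_mono power_mono mult_pos_pos) auto
    finally show "real (card {Q \<in> grid. hit k d P Q}) \<le> 9 * x\<^sup>2 / y ^ (k - 1) * (1 / real d ^ 2)"
      by simp
  qed
  also have "\<dots> = real N * (9 * x\<^sup>2 / y ^ (k - 1) * (\<Sum>d\<in>R. 1 / real d ^ 2))"
    by (simp only: sum_distrib_left[symmetric] sum_constant) (rule mult.left_commute)
  also have "\<dots> \<le> real N * (9 * x\<^sup>2 / y ^ (k - 1) * (2 / y))"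
    using assms finR by (intro mult_left_mono sum_inverse_squares_tail) (auto simp: R_def)
  also have "9 * x\<^sup>2 / y ^ (k - 1) * (2 / y) = 18 * x\<^sup>2 / y ^ k"
    using k_pos by (cases k) (auto simp: mult_ac)
  finally show ?thesis .
qed

end

section \<open>Error bounds\<close>

lemma sum_prod_odd_prime_sets:
  assumes "F \<subseteq> odd_prime_sets"
  shows "(\<Sum>U\<in>F. h (\<Prod>U)) = (\<Sum>n\<in>\<Prod> ` F. h n)"
  by (subst sum.reindex[OF inj_on_subset[OF inj_on_prod_odd_prime_sets assms]]) simp

text \<open>Since \<open>N \<le> k \<le> 2 ^ (k - 1)\<close>, the factor \<open>N\<close> of each
  prime is absorbed by \<open>p ^ (k - 1)\<close>, which leaves inverse squares.\<close>

lemma tail_sum_small_card: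
  assumes "1 \<le> k" "N \<le> k" "z \<ge> 1" "finite F" "F \<subseteq> odd_prime_sets - odd_prime_sets_upto z"
  shows "(\<Sum>U\<in>F. real N ^ card U / real (\<Prod>U) ^ (k + 1)) \<le> 2 / z"
proof -
  have "(\<Sum>U\<in>F. real N ^ card U / real (\<Prod>U) ^ (k + 1)) \<le> (\<Sum>U\<in>F. 1 / real (\<Prod>U) ^ 2)"
  proof (rule sum_mono)
    fix U assume "U \<in> F"
    then have U: "U \<in> odd_prime_sets" using assms by auto
    have D: "real (\<Prod>U) > 0" using prod_odd_prime_set_pos[OF U] by (simp only: of_nat_0_less_iff)
    have "real N ^ card U = (\<Prod>p\<in>U. real N)" by simp
    also have "\<dots> \<le> (\<Prod>p\<in>U. real p ^ (k - 1))"
    proof (intro prod_mono conjI)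
      fix p assume p: "p \<in> U"
      have "N \<le> 2 ^ (k - 1)" using less_exp[of "k - 1"] assms(1,2) by linarith
      also have "\<dots> \<le> p ^ (k - 1)" using odd_prime_setsD(3)[OF U p] by (intro power_mono) auto
      finally show "real N \<le> real p ^ (k - 1)" by (simp only: of_nat_le_iff of_nat_power[symmetric])
    qed simp
    also have "\<dots> = real (\<Prod>U) ^ (k - 1)" by (simp add: prod_power_distrib)
    finally have "real N ^ card U / real (\<Prod>U) ^ (k + 1) \<le> real (\<Prod>U) ^ (k - 1) / real (\<Prod>U) ^ (k + 1)"
      using D by (intro divide_right_mono) auto
    also have "\<dots> = 1 / real (\<Prod>U) ^ 2"
    proof -
      have "k + 1 = (k - 1) + 2" using assms(1) by simp
      then have "real (\<Prod>U) ^ (k + 1) = real (\<Prod>U) ^ (k - 1) * real (\<Prod>U) ^ 2" by (metis power_add)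
      then show ?thesis using D by simp
    qed
    finally show "real N ^ card U / real (\<Prod>U) ^ (k + 1) \<le> 1 / real (\<Prod>U) ^ 2" .
  qed
  also have "\<dots> = (\<Sum>n\<in>\<Prod> ` F. 1 / real n ^ 2)"
    using assms(5) by (intro sum_prod_odd_prime_sets) auto
  also have "\<dots> \<le> 2 / z"
    using assms(3,4,5) by (intro sum_inverse_squares_tail) (auto simp: odd_prime_sets_upto_def not_le)
  finally show ?thesis .
qed

text \<open>For larger \<open>N\<close> the comparison with \<open>p ^ (k - 1)\<close> may fail; a
  bound by a square root instead leaves the exponent \<open>k + 1 / 2\<close>, split into
  \<open>k - 1\<close> for the power of \<open>z\<close> and \<open>3 / 2\<close> for the convergent
  tail.\<close>

lemma tail_sum_sqrt:
  assumes "1 \<le> k" "z \<ge> 1" "finite F" "F \<subseteq> odd_prime_sets - odd_prime_sets_upto z" "C \<ge> 0"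
    and C: "\<And>U. U \<in> odd_prime_sets \<Longrightarrow> real N ^ card U \<le> C * sqrt (real (\<Prod>U))"
  shows "(\<Sum>U\<in>F. real N ^ card U / real (\<Prod>U) ^ (k + 1)) \<le> 4 * C / (z ^ (k - 1) * sqrt z)"
proof -
  have "(\<Sum>U\<in>F. real N ^ card U / real (\<Prod>U) ^ (k + 1)) \<le>
    (\<Sum>U\<in>F. C / z ^ (k - 1) * (1 / (real (\<Prod>U) * sqrt (real (\<Prod>U)))))"
  proof (rule sum_mono)
    fix U assume UF: "U \<in> F"
    define D where "D = real (\<Prod>U)"
    have U: "U \<in> odd_prime_sets" "D > z"
      using assms(4) UF by (auto simp: odd_prime_sets_upto_def D_def not_le)
    have D: "D > 0" using U(2) assms(2) by simp
    have "k + 1 = (k - 1) + 2" using assms(1) by simp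
    then have e: "D ^ (k + 1) = D ^ (k - 1) * D ^ 2" by (metis power_add)
    have sq: "D ^ 2 = D * sqrt D * sqrt D" using D by (simp add: power2_eq_square)
    have "real N ^ card U / D ^ (k + 1) \<le> C * sqrt D / D ^ (k + 1)"
      using C[OF U(1)] D by (intro divide_right_mono) (auto simp: D_def)
    also have "\<dots> = C / (D ^ (k - 1) * (D * sqrt D))" unfolding e sq using D by simp
    also have "\<dots> \<le> C / (z ^ (k - 1) * (D * sqrt D))"
      using D U(2) assms(2,5) by (intro divide_left_mono mult_right_mono power_mono mult_pos_pos) auto
    finally show "real N ^ card U / real (\<Prod>U) ^ (k + 1) \<le>
      C / z ^ (k - 1) * (1 / (real (\<Prod>U) * sqrt (real (\<Prod>U))))"
      unfolding D_def[symmetric] by simp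
  qed
  also have "\<dots> = C / z ^ (k - 1) * (\<Sum>U\<in>F. 1 / (real (\<Prod>U) * sqrt (real (\<Prod>U))))"
    by (rule sum_distrib_left[symmetric])
  also have "(\<Sum>U\<in>F. 1 / (real (\<Prod>U) * sqrt (real (\<Prod>U)))) = (\<Sum>n\<in>\<Prod> ` F. 1 / (real n * sqrt (real n)))"
    using assms(4) by (intro sum_prod_odd_prime_sets) auto
  also have "C / z ^ (k - 1) * (\<Sum>n\<in>\<Prod> ` F. 1 / (real n * sqrt (real n))) \<le> C / z ^ (k - 1) * (4 / sqrt z)"
    using assms(2-5)
    by (intro mult_left_mono sum_inverse_three_halves_tail) (auto simp: odd_prime_sets_upto_def not_le)
  finally show ?thesis by (simp add: mult_ac)
qed

section \<open>The two ranges of the cardinality\<close>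

context visible_set
begin

lemma E2_bound_small_card:
  assumes "1 \<le> N" "N \<le> k"
  shows "\<bar>E2 k S x\<bar> \<le> (3 * real k + 8 * real k * (real k + 1)\<^sup>2) * 4 ^ k * (x * ln x ^ N)"
proof -
  have "1 / 2 \<le> ln (2::real)" using ln2_ge_two_thirds by simp
  also have "\<dots> \<le> ln x" using x_ge by simp
  finally have lnx: "1 / 2 \<le> ln x" .
  \<comment> \<open>For \<open>N \<le> k\<close> no product of hit primes exceeds
    \<open>2 * x\<close>, so with this level the sieve is exact.\<close>
  have "sieve_tail (2 * x) = 0"
  proof -
    have "real (\<Prod>(hit_primes Q)) \<le> 2 * x" if Q: "Q \<in> grid" for Q
    proof -
      have "real (\<Prod>(hit_primes Q)) ^ k \<le> (2 * x) ^ N" by (rule prod_hit_primes_power_le[OF Q])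
      also have "\<dots> \<le> (2 * x) ^ k" using assms x_ge by (intro power_increasing) auto
      finally show ?thesis
        using x_ge k_pos power_mono_iff[of "real (\<Prod>(hit_primes Q))" "2 * x" k]
        by (simp add: prod_nonneg)
    qed
    then have "{Q. Q \<in> grid \<and> real (\<Prod>(hit_primes Q)) > 2 * x} = {}" by force
    then show ?thesis unfolding sieve_tail_def by (simp only: sum.empty)
  qed
  moreover have "\<bar>E2 k S x\<bar> \<le> real N * x + 2 * real N *
    ((real N + 1)\<^sup>2 * (2 * x + 2 * x) * (1 + ln (2 * x)) ^ N + x\<^sup>2 * (2 / (2 * x)) + sieve_tail (2 * x))"
    using x_ge assms k_pos by (intro E2_estimate tail_sum_small_card) auto
  moreover have "x\<^sup>2 * (2 / (2 * x)) = x" using x_ge by (simp add: power2_eq_square)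
  ultimately have 1: "\<bar>E2 k S x\<bar> \<le> real N * x + 2 * real N *
    ((real N + 1)\<^sup>2 * (4 * x) * (1 + ln (2 * x)) ^ N + x)" by simp
  define Y where "Y = x * (4 * ln x) ^ N"
  have xY: "x \<le> Y"
  proof -
    have "1 \<le> (4 * ln x) ^ N" using lnx by (intro one_le_power) simp
    then show ?thesis unfolding Y_def using x_ge mult_left_mono[of 1 "(4 * ln x) ^ N" x] by simp
  qed
  \<comment> \<open>As \<open>ln x \<ge> 1 / 2\<close>, the \<open>1\<close> costs
    \<open>2 * ln x\<close>; the \<open>ln 2\<close> costs another \<open>ln x\<close>.\<close>
  have "1 + ln (2 * x) \<le> 4 * ln x"
  proof -
    have "ln (2 * x) = ln 2 + ln x" using x_ge by (simp add: ln_mult)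
    moreover have "ln 2 \<le> ln x" using x_ge by simp
    ultimately show ?thesis using lnx by linarith
  qed
  then have "x * (1 + ln (2 * x)) ^ N \<le> Y" unfolding Y_def
    using x_ge by (intro mult_left_mono power_mono add_nonneg_nonneg) auto
  then have "4 * (real N + 1)\<^sup>2 * (x * (1 + ln (2 * x)) ^ N) \<le> 4 * (real N + 1)\<^sup>2 * Y"
    by (intro mult_left_mono) auto
  then have "(real N + 1)\<^sup>2 * (4 * x) * (1 + ln (2 * x)) ^ N + x \<le> 4 * (real N + 1)\<^sup>2 * Y + Y"
    using xY by (intro add_mono) (simp_all only: mult_ac)
  then have "2 * real N * ((real N + 1)\<^sup>2 * (4 * x) * (1 + ln (2 * x)) ^ N + x) \<le>
      2 * real N * (4 * (real N + 1)\<^sup>2 * Y + Y)"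
    by (intro mult_left_mono) auto
  moreover have "real N * x \<le> real N * Y" using xY by (intro mult_left_mono) auto
  ultimately have "\<bar>E2 k S x\<bar> \<le> real N * Y + 2 * real N * (4 * (real N + 1)\<^sup>2 * Y + Y)"
    using 1 by linarith
  also have "\<dots> = (3 * real N + 8 * real N * (real N + 1)\<^sup>2) * Y" by (simp add: algebra_simps)
  also have "\<dots> = (3 * real N + 8 * real N * (real N + 1)\<^sup>2) * 4 ^ N * (x * ln x ^ N)"
    by (simp add: Y_def power_mult_distrib)
  \<comment> \<open>Replacing \<open>N\<close> by \<open>k\<close> makes the constant depend on
    \<open>k\<close> alone.\<close>
  also have "\<dots> \<le> (3 * real k + 8 * real k * (real k + 1)\<^sup>2) * 4 ^ k * (x * ln x ^ N)"
    using assms lnx x_ge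
    by (intro mult_mono mult_right_mono add_mono power_mono power_increasing) auto
  finally show ?thesis .
qed

text \<open>The weight \<open>2 ^ card U\<close> is at most a small power of the product, which is
  itself at most \<open>x ^ (2 * K)\<close>; the number of points is controlled by
  \<open>card_large_hit_primes\<close>.\<close>

lemma sieve_tail_le:
  assumes "y \<ge> 1" "\<delta> > 0" "C \<ge> 0" "N \<le> K"
    and C: "\<And>U. U \<in> odd_prime_sets \<Longrightarrow> 2 ^ card U \<le> C * real (\<Prod>U) powr \<delta>"
  shows "sieve_tail (y ^ N) \<le> real N * (18 * x\<^sup>2 / y ^ k) * (C * x powr (2 * real K * \<delta>))"
proof -
  have "sieve_tail (y ^ N) \<le>
    (\<Sum>Q | Q \<in> grid \<and> real (\<Prod>(hit_primes Q)) > y ^ N. C * x powr (2 * real K * \<delta>))"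
    unfolding sieve_tail_def
  proof (rule sum_mono)
    fix Q assume "Q \<in> {Q. Q \<in> grid \<and> real (\<Prod>(hit_primes Q)) > y ^ N}"
    then have Q: "Q \<in> grid" by simp
    define D where "D = real (\<Prod>(hit_primes Q))"
    have "\<Prod>(hit_primes Q) \<ge> 1" using prod_odd_prime_set_pos[OF hit_primes_in[OF Q]] by simp
    then have D: "D \<ge> 1" unfolding D_def by (simp only: real_of_nat_ge_one_iff)
    have "D \<le> D ^ k" using D k_pos by (simp add: self_le_power)
    also have "\<dots> \<le> (2 * x) ^ N" unfolding D_def by (rule prod_hit_primes_power_le[OF Q])
    also have "\<dots> \<le> (2 * x) ^ K" using x_ge assms(4) by (intro power_increasing) auto
    \<comment> \<open>Here \<open>2 \<le> x\<close> is used, to express the bound in powers of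
      \<open>x\<close> alone.\<close>
    also have "\<dots> \<le> (x * x) ^ K" using x_ge by (intro power_mono mult_right_mono) auto
    also have "\<dots> = x ^ (2 * K)" by (simp add: power_mult power2_eq_square)
    also have "\<dots> = x powr (2 * real K)" using x_ge powr_realpow[of x "2 * K"] by simp
    finally have "D powr \<delta> \<le> (x powr (2 * real K)) powr \<delta>"
      using D assms(2) by (intro powr_mono2) auto
    then have "C * D powr \<delta> \<le> C * x powr (2 * real K * \<delta>)"
      using assms(3) by (intro mult_left_mono) (auto simp: powr_powr)
    then show "2 ^ card (hit_primes Q) \<le> C * x powr (2 * real K * \<delta>)"
      using C[OF hit_primes_in[OF Q]] unfolding D_def by linarith
  qed
  also have "\<dots> = real (card {Q \<in> grid. real (\<Prod>(hit_primes Q)) > y ^ N}) * (C * x powr (2 * real K * \<delta>))"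
    by (simp only: sum_constant)
  also have "\<dots> \<le> real N * (18 * x\<^sup>2 / y ^ k) * (C * x powr (2 * real K * \<delta>))"
    using assms by (intro mult_right_mono card_large_hit_primes) auto
  finally show ?thesis .
qed

text \<open>The auxiliary constants \<open>C1\<close>, \<open>C2\<close>, \<open>C3\<close> enter as
  hypotheses stated with the upper bound \<open>K\<close> of \<open>N\<close>, so that they can be
  fixed before \<open>S\<close> and \<open>x\<close>.\<close>

lemma E2_bound_large_card:
  assumes "k < N" "N \<le> K" "\<epsilon> > 0" "C1 \<ge> 0" "C2 \<ge> 0" "C3 \<ge> 0"
    and C1: "\<And>U. U \<in> odd_prime_sets \<Longrightarrow> real K ^ card U \<le> C1 * sqrt (real (\<Prod>U))"
    and C2: "\<And>U. U \<in> odd_prime_sets \<Longrightarrow> 2 ^ card U \<le> C2 * real (\<Prod>U) powr (\<epsilon> / (2 * real K))"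
    and C3: "(1 + 2 * ln x) ^ K \<le> C3 * x powr \<epsilon>"
  shows "\<bar>E2 k S x\<bar> \<le> (real K + 2 * real K * (3 * (real K + 1)\<^sup>2 * C3 + 4 * C1 + 18 * real K * C2)) *
    x powr (2 - 2 * real k / (real N + real k) + \<epsilon>)"
proof -
  define \<theta> where "\<theta> = 2 - 2 * real k / (real N + real k)"
  \<comment> \<open>Sieving up to \<open>z = y ^ N\<close> costs about \<open>z\<close>, the points
    beyond about \<open>x\<^sup>2 / y ^ k\<close>; this exponent makes both equal to
    \<open>x powr \<theta>\<close>.\<close>
  define y where "y = x powr (2 / (real N + real k))"
  define z where "z = y ^ N"
  define n where "n = (real K + 1)\<^sup>2"
  have x0: "x > 0" "x \<ge> 1" using x_ge by auto
  have Nk: "real N + real k > 0" "real k < real N" "real k \<ge> 1" using assms k_pos by auto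
  have K: "real N \<le> real K" "K > 0" using assms by auto
  have \<theta>: "\<theta> = 2 * real N / (real N + real k)" using Nk by (simp add: \<theta>_def field_simps)
  have \<theta>12: "1 \<le> \<theta>" "\<theta> \<le> 2" using Nk by (auto simp: \<theta> \<theta>_def field_simps)
  have y1: "y \<ge> 1" unfolding y_def using x0 Nk by (intro ge_one_powr_ge_zero) auto
  have zx: "z = x powr \<theta>"
    unfolding z_def y_def \<theta> using x0 by (simp add: powr_realpow[symmetric] powr_powr mult_ac)
  have yk: "x\<^sup>2 / y ^ k = x powr \<theta>"
  proof -
    have "y ^ k = x powr (2 * real k / (real N + real k))"
      unfolding y_def using x0 by (simp add: powr_realpow[symmetric] powr_powr mult_ac)
    moreover have "x\<^sup>2 = x powr 2" using x0 by simp
    ultimately show ?thesis by (simp only: \<theta>_def powr_diff)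
  qed
  \<comment> \<open>\<open>N > k\<close> gives \<open>\<theta> \<ge> 1\<close>, so the terms linear
    in \<open>x\<close> are absorbed by \<open>z\<close>.\<close>
  have xz: "x \<le> z" using powr_mono[of 1 \<theta> x] \<theta>12 x0 zx by simp
  then have z1: "z \<ge> 1" using x0 by simp
  define Z where "Z = x powr (\<theta> + \<epsilon>)"
  have zZ: "z \<le> Z" unfolding zx Z_def using x0 assms by (intro powr_mono) auto
  have ze: "z * x powr \<epsilon> = Z" unfolding zx Z_def by (simp add: powr_add)
  have Z0: "Z \<ge> 0" by (simp add: Z_def)
  define \<tau> where "\<tau> = 4 * C1 / (z ^ (k - 1) * sqrt z)"
  have est: "\<bar>E2 k S x\<bar> \<le> real N * x + 2 * real N *
    ((real N + 1)\<^sup>2 * (2 * x + z) * (1 + ln z) ^ N + x\<^sup>2 * \<tau> + sieve_tail z)"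
  proof (rule E2_estimate[OF z1])
    fix F :: "nat set set" assume F: "finite F" "F \<subseteq> odd_prime_sets - odd_prime_sets_upto z"
    have "real N ^ card U \<le> C1 * sqrt (real (\<Prod>U))" if "U \<in> odd_prime_sets" for U
      using C1[OF that] power_mono[of "real N" "real K" "card U"] K by linarith
    then show "(\<Sum>U\<in>F. real N ^ card U / real (\<Prod>U) ^ (k + 1)) \<le> \<tau>"
      unfolding \<tau>_def using assms F z1 k_pos by (intro tail_sum_sqrt) auto
  qed
  have b1: "(real N + 1)\<^sup>2 * (2 * x + z) * (1 + ln z) ^ N \<le> 3 * n * C3 * Z"
  proof -
    have "1 + ln z \<le> 1 + 2 * ln x"
      unfolding zx using x0 \<theta>12 by (simp add: ln_powr mult_right_mono)
    then have "(1 + ln z) ^ N \<le> (1 + 2 * ln x) ^ N" using z1 by (intro power_mono) auto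
    also have "\<dots> \<le> (1 + 2 * ln x) ^ K" using x0 assms by (intro power_increasing) auto
    finally have "(1 + ln z) ^ N \<le> C3 * x powr \<epsilon>" using C3 by linarith
    moreover have "(real N + 1)\<^sup>2 * (2 * x + z) \<le> n * (3 * z)"
    proof (rule mult_mono)
      show "(real N + 1)\<^sup>2 \<le> n" unfolding n_def using K by (intro power_mono) auto
    qed (use xz x0 z1 in \<open>simp_all add: n_def\<close>)
    moreover have "0 \<le> n * (3 * z)" "0 \<le> (1 + ln z) ^ N" using z1 by (simp_all add: n_def)
    ultimately have "(real N + 1)\<^sup>2 * (2 * x + z) * (1 + ln z) ^ N \<le> n * (3 * z) * (C3 * x powr \<epsilon>)"
      using mult_mono by blast
    also have "\<dots> = 3 * n * C3 * (z * x powr \<epsilon>)" by simp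
    finally show ?thesis unfolding ze .
  qed
  have b2: "x\<^sup>2 * \<tau> \<le> 4 * C1 * Z"
  proof -
    \<comment> \<open>This is the inequality of exponents behind
      \<open>x\<^sup>2 \<le> z * (z ^ (k - 1) * sqrt z)\<close>; it follows from
      \<open>N \<ge> k + 1\<close>.\<close>
    have "real k \<le> real N * (real k - 1 / 2)"
    proof -
      have "(real k + 1) * (real k - 1 / 2) \<le> real N * (real k - 1 / 2)"
        using assms Nk by (intro mult_right_mono) auto
      moreover have "(real k + 1) * (real k - 1 / 2) - real k = (real k - 1) * (real k + 1 / 2)"
        by (simp add: field_simps)
      moreover have "0 \<le> (real k - 1) * (real k + 1 / 2)" using Nk by (intro mult_nonneg_nonneg) auto
      ultimately show ?thesis by linarith
    qed
    then have "2 * real k / (real N + real k) \<le> 2 * (real N * (real k - 1 / 2)) / (real N + real k)"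
      using Nk by (intro divide_right_mono mult_left_mono) auto
    also have "\<dots> = \<theta> * (real k - 1 / 2)" unfolding \<theta> by (simp only: mult.assoc times_divide_eq_left)
    finally have "2 - \<theta> \<le> \<theta> * (real k - 1 / 2)" by (simp add: \<theta>_def)
    then have "2 \<le> \<theta> + \<theta> * (real k - 1 / 2)" by simp
    then have "x powr 2 \<le> x powr (\<theta> + \<theta> * (real k - 1 / 2))" using x0 by (intro powr_mono) auto
    also have "\<dots> = z * (z ^ (k - 1) * sqrt z)"
    proof -
      have "z ^ (k - 1) = x powr (\<theta> * (real k - 1))"
        using x0 k_pos unfolding zx by (simp add: powr_realpow[symmetric] powr_powr of_nat_diff)
      moreover have "sqrt z = x powr (\<theta> * (1 / 2))"
        using x0 unfolding zx by (simp add: powr_half_sqrt[symmetric] powr_powr)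
      moreover have "\<theta> * (real k - 1 / 2) = \<theta> * (real k - 1) + \<theta> * (1 / 2)" by (simp add: algebra_simps)
      ultimately show ?thesis by (simp only: powr_add zx)
    qed
    finally have "x\<^sup>2 \<le> z * (z ^ (k - 1) * sqrt z)" using x0 by simp
    then have "x\<^sup>2 / (z ^ (k - 1) * sqrt z) \<le> z"
      using z1 by (subst pos_divide_le_eq) auto
    then have "4 * C1 * (x\<^sup>2 / (z ^ (k - 1) * sqrt z)) \<le> 4 * C1 * Z"
      using zZ assms by (intro mult_left_mono) auto
    then show ?thesis by (simp add: \<tau>_def mult_ac)
  qed
  have b3: "sieve_tail z \<le> 18 * real K * C2 * Z"
  proof -
    \<comment> \<open>The exponent \<open>\<epsilon> / (2 * K)\<close> is chosen so that the weights
      cost exactly \<open>x powr \<epsilon>\<close>.\<close>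
    have "sieve_tail z \<le> real N * (18 * x\<^sup>2 / y ^ k) * (C2 * x powr (2 * real K * (\<epsilon> / (2 * real K))))"
      unfolding z_def using y1 assms K C2 by (intro sieve_tail_le) auto
    also have "2 * real K * (\<epsilon> / (2 * real K)) = \<epsilon>" using K by simp
    also have "18 * x\<^sup>2 / y ^ k = 18 * z" unfolding zx yk[symmetric] by simp
    also have "real N * (18 * z) * (C2 * x powr \<epsilon>) = 18 * real N * C2 * (z * x powr \<epsilon>)" by simp
    also have "\<dots> = 18 * real N * C2 * Z" unfolding ze ..
    also have "\<dots> \<le> 18 * real K * C2 * Z" using K Z0 assms by (intro mult_right_mono) auto
    finally show ?thesis .
  qed
  define M where "M = 3 * n * C3 + 4 * C1 + 18 * real K * C2"
  have "2 * real N * ((real N + 1)\<^sup>2 * (2 * x + z) * (1 + ln z) ^ N + x\<^sup>2 * \<tau> + sieve_tail z)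
      \<le> 2 * real N * (M * Z)"
    using b1 b2 b3 unfolding M_def by (intro mult_left_mono) (simp_all add: distrib_right)
  also have "\<dots> \<le> 2 * real K * (M * Z)"
    using K assms Z0 by (intro mult_right_mono) (simp_all add: M_def n_def)
  finally have "2 * real N * ((real N + 1)\<^sup>2 * (2 * x + z) * (1 + ln z) ^ N + x\<^sup>2 * \<tau> + sieve_tail z)
      \<le> 2 * real K * (M * Z)" .
  moreover have "real N * x \<le> real K * Z" using K xz zZ x0 by (intro mult_mono) auto
  ultimately have "\<bar>E2 k S x\<bar> \<le> real K * Z + 2 * real K * (M * Z)"
    using est by linarith
  also have "\<dots> = (real K + 2 * real K * M) * Z" by (simp add: distrib_right)
  finally have "\<bar>E2 k S x\<bar> \<le> (real K + 2 * real K * M) * Z" .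
  then show ?thesis unfolding M_def n_def Z_def \<theta>_def .
qed

end

section \<open>Passage to all heights and choice of constants\<close>

lemma N1_le_square: "x \<ge> 0 \<Longrightarrow> real (N1 k S x) \<le> x\<^sup>2"
  and N2_le_square: "x \<ge> 0 \<Longrightarrow> real (N2 k S x) \<le> x\<^sup>2"
proof -
  assume x: "x \<ge> 0"
  define B where "B = {m. 1 \<le> m \<and> real_of_int m \<le> x}"
  have B: "finite B" "real (card B) \<le> x"
    unfolding B_def by (rule finite_ints_upto, rule card_ints_upto[OF x])
  have *: "real (card W) \<le> x\<^sup>2" if "W \<subseteq> B \<times> B" for W
  proof -
    have "card W \<le> card (B \<times> B)" using that B by (intro card_mono) auto
    then have "real (card W) \<le> real (card B * card B)"
      by (simp only: card_cartesian_product of_nat_le_iff)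
    also have "\<dots> \<le> x\<^sup>2" using B x by (simp add: power2_eq_square mult_mono)
    finally show ?thesis .
  qed
  show "real (N1 k S x) \<le> x\<^sup>2" unfolding N1_def by (rule *) (auto simp: V1_def B_def)
  show "real (N2 k S x) \<le> x\<^sup>2" unfolding N2_def by (rule *) (auto simp: V2_def B_def)
qed

text \<open>From some \<open>X\<close> on, \<open>S\<close> lies in the box and \<open>bound\<close>
  applies. Below \<open>X\<close> the trivial estimate by \<open>(2 + M) * X\<^sup>2\<close>,
  compared with the lower bound \<open>c\<close> of \<open>g\<close>, supplies a constant that
  depends on \<open>S\<close>.\<close>

lemma E2_boundI:
  assumes "finite S" "c > 0" "\<And>x. x \<ge> 2 \<Longrightarrow> c \<le> g x"
    and bound: "\<And>x. x \<ge> 2 \<Longrightarrow>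
      (\<And>P. P \<in> S \<Longrightarrow> \<bar>real_of_int (fst P)\<bar> \<le> x \<and> \<bar>real_of_int (snd P)\<bar> \<le> x) \<Longrightarrow>
      \<bar>E2 k S x\<bar> \<le> C * g x"
  shows "E2_bound k S C g"
proof -
  define X where "X = (\<Sum>P\<in>S. \<bar>real_of_int (fst P)\<bar> + \<bar>real_of_int (snd P)\<bar>)"
  define M where "M = \<bar>(real (card S) / 2 ^ (k + 1)) * (1 - 1 / 2 ^ (k + 1)) * odd_prime_product k (card S)\<bar>"
  have X: "\<bar>real_of_int (fst P)\<bar> \<le> X \<and> \<bar>real_of_int (snd P)\<bar> \<le> X" if "P \<in> S" for P
  proof -
    have "\<bar>real_of_int (fst P)\<bar> + \<bar>real_of_int (snd P)\<bar> \<le> X"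
      unfolding X_def using that assms(1)
      by (intro member_le_sum[of P S "\<lambda>P. \<bar>real_of_int (fst P)\<bar> + \<bar>real_of_int (snd P)\<bar>"]) auto
    then show ?thesis by linarith
  qed
  define C' where "C' = max C ((2 + M) * X\<^sup>2 / c)"
  have "\<bar>E2 k S x\<bar> \<le> C' * g x" if x: "x \<ge> 2" for x
  proof (cases "x \<ge> X")
    case True
    then have "\<bar>E2 k S x\<bar> \<le> C * g x" using X x by (intro bound) force+
    also have "\<dots> \<le> C' * g x"
      using assms(2) assms(3)[OF x] by (intro mult_right_mono) (auto simp: C'_def)
    finally show ?thesis .
  next
    case False
    have "\<bar>E2 k S x\<bar> \<le> real (N2 k S x) + real (N1 k S x) + x\<^sup>2 * M"
    proof -
      have "x\<^sup>2 * M = \<bar>x\<^sup>2 * (real (card S) / 2 ^ (k + 1)) * (1 - 1 / 2 ^ (k + 1)) * odd_prime_product k (card S)\<bar>"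
        unfolding M_def by (simp add: abs_mult mult_ac)
      then show ?thesis unfolding E2_def by linarith
    qed
    also have "\<dots> \<le> x\<^sup>2 + x\<^sup>2 + x\<^sup>2 * M" using x by (intro add_mono N1_le_square N2_le_square) auto
    also have "\<dots> = (2 + M) * x\<^sup>2" by (simp add: algebra_simps)
    also have "\<dots> \<le> (2 + M) * X\<^sup>2" using False x
      by (intro mult_left_mono power_mono) (auto simp: M_def)
    also have "\<dots> = (2 + M) * X\<^sup>2 / c * c" using assms(2) by simp
    also have "\<dots> \<le> C' * g x"
      using assms(2) assms(3)[OF x] by (intro mult_mono) (auto simp: C'_def M_def le_max_iff_disj)
    finally show ?thesis .
  qed
  then show ?thesis unfolding E2_bound_def using bound by blast
qed

lemma one_plus_ln_power_le:
  fixes \<epsilon> :: real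
  assumes "\<epsilon> > 0" "K > 0"
  obtains C where "C \<ge> 0" "\<And>x. x \<ge> 1 \<Longrightarrow> (1 + 2 * ln x) ^ K \<le> C * x powr \<epsilon>"
proof -
  \<comment> \<open>Each of the \<open>K\<close> factors may grow like
    \<open>x powr (\<epsilon> / K)\<close>.\<close>
  define a where "a = \<epsilon> / real K"
  have a: "a > 0" using assms by (simp add: a_def)
  have "(1 + 2 * ln x) ^ K \<le> (1 + 2 / a) ^ K * x powr \<epsilon>" if x: "x \<ge> 1" for x
  proof -
    have "ln x \<le> x powr a / a" using ln_powr_bound[OF x a] .
    moreover have "1 \<le> x powr a" using x a by (intro ge_one_powr_ge_zero) auto
    ultimately have "1 + 2 * ln x \<le> (1 + 2 / a) * x powr a" by (simp add: distrib_right)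
    then have "(1 + 2 * ln x) ^ K \<le> ((1 + 2 / a) * x powr a) ^ K"
      using x by (intro power_mono) auto
    also have "\<dots> = (1 + 2 / a) ^ K * x powr \<epsilon>"
      using x assms by (simp add: power_mult_distrib a_def powr_realpow[symmetric] powr_powr)
    finally show ?thesis .
  qed
  then show thesis using that[of "(1 + 2 / a) ^ K"] a by simp
qed

theorem theorem2:
  fixes k :: nat
  assumes "k \<ge> 1"
  shows
    "(\<exists>C. \<forall>S. finite S \<and> pairwise (visible1 k) S \<and> card S \<le> 2 ^ (k + 1) \<and>
         1 \<le> card S \<and> card S \<le> k \<longrightarrow>
         E2_bound k S C (\<lambda>x. x * ln x ^ card S)) \<and>
     (\<forall>\<epsilon>>0. \<exists>C. \<forall>S. finite S \<and> pairwise (visible1 k) S \<and> card S \<le> 2 ^ (k + 1) \<and>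
         k < card S \<longrightarrow>
         E2_bound k S C
           (\<lambda>x. x powr (2 - 2 * real k / (real (card S) + real k) + \<epsilon>)))"
proof (intro conjI allI impI)
  define C where "C = (3 * real k + 8 * real k * (real k + 1)\<^sup>2) * 4 ^ k"
  show "\<exists>C. \<forall>S. finite S \<and> pairwise (visible1 k) S \<and> card S \<le> 2 ^ (k + 1) \<and>
      1 \<le> card S \<and> card S \<le> k \<longrightarrow> E2_bound k S C (\<lambda>x. x * ln x ^ card S)"
  proof (intro exI allI impI)
    fix S :: "(int \<times> int) set"
    assume S: "finite S \<and> pairwise (visible1 k) S \<and> card S \<le> 2 ^ (k + 1) \<and> 1 \<le> card S \<and> card S \<le> k"
    show "E2_bound k S C (\<lambda>x. x * ln x ^ card S)"
    proof (rule E2_boundI)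
      show "finite S" using S by simp
      \<comment> \<open>The positive lower bound is the value at \<open>x = 2\<close> of the
        increasing comparison function.\<close>
      show "2 * ln 2 ^ card S > (0::real)" by simp
      show "2 * ln 2 ^ card S \<le> x * ln x ^ card S" if "x \<ge> 2" for x :: real
        using that by (intro mult_mono power_mono) auto
      fix x :: real
      assume x: "x \<ge> 2"
        and box: "\<And>P. P \<in> S \<Longrightarrow> \<bar>real_of_int (fst P)\<bar> \<le> x \<and> \<bar>real_of_int (snd P)\<bar> \<le> x"
      interpret visible_set k S x using assms S x box by unfold_locales auto
      show "\<bar>E2 k S x\<bar> \<le> C * (x * ln x ^ card S)"
        unfolding C_def using S by (intro E2_bound_small_card) auto
    qed
  qed
next
  fix \<epsilon> :: real assume \<epsilon>: "\<epsilon> > 0"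
  \<comment> \<open>The largest admissible cardinality; constants formed with it serve every
    \<open>S\<close>.\<close>
  define K :: nat where "K = 2 ^ (k + 1)"
  have "K > 0" by (simp add: K_def)
  then have K: "real K \<ge> 1" "K > 0" by simp_all
  obtain C1 where C1: "C1 \<ge> 1" "\<And>U. U \<in> odd_prime_sets \<Longrightarrow> real K ^ card U \<le> C1 * real (\<Prod>U) powr (1 / 2)"
    using pow_card_le_prod_powr[OF K(1), of "1 / 2"] by auto
  obtain C2 where C2: "C2 \<ge> 1"
    "\<And>U. U \<in> odd_prime_sets \<Longrightarrow> 2 ^ card U \<le> C2 * real (\<Prod>U) powr (\<epsilon> / (2 * real K))"
    using pow_card_le_prod_powr[of 2 "\<epsilon> / (2 * real K)"] \<epsilon> K by auto
  obtain C3 where C3: "C3 \<ge> 0" "\<And>x. x \<ge> 1 \<Longrightarrow> (1 + 2 * ln x) ^ K \<le> C3 * x powr \<epsilon>"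
    using one_plus_ln_power_le[OF \<epsilon> K(2)] by auto
  have C1': "real K ^ card U \<le> C1 * sqrt (real (\<Prod>U))" if "U \<in> odd_prime_sets" for U
    using C1(2)[OF that] by (simp only: powr_half_sqrt of_nat_0_le_iff)
  define C where "C = real K + 2 * real K * (3 * (real K + 1)\<^sup>2 * C3 + 4 * C1 + 18 * real K * C2)"
  show "\<exists>C. \<forall>S. finite S \<and> pairwise (visible1 k) S \<and> card S \<le> 2 ^ (k + 1) \<and> k < card S \<longrightarrow>
      E2_bound k S C (\<lambda>x. x powr (2 - 2 * real k / (real (card S) + real k) + \<epsilon>))"
  proof (intro exI allI impI)
    fix S :: "(int \<times> int) set"
    assume S: "finite S \<and> pairwise (visible1 k) S \<and> card S \<le> 2 ^ (k + 1) \<and> k < card S"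
    show "E2_bound k S C (\<lambda>x. x powr (2 - 2 * real k / (real (card S) + real k) + \<epsilon>))"
    proof (rule E2_boundI)
      show "finite S" using S by simp
      show "(1::real) > 0" by simp
      show "1 \<le> x powr (2 - 2 * real k / (real (card S) + real k) + \<epsilon>)" if "x \<ge> 2" for x :: real
      proof -
        have "2 * real k / (real (card S) + real k) \<le> 2" using S by (simp add: field_simps)
        then show ?thesis using that \<epsilon> by (intro ge_one_powr_ge_zero) auto
      qed
      fix x :: real
      assume x: "x \<ge> 2"
        and box: "\<And>P. P \<in> S \<Longrightarrow> \<bar>real_of_int (fst P)\<bar> \<le> x \<and> \<bar>real_of_int (snd P)\<bar> \<le> x"
      interpret visible_set k S x using assms S x box by unfold_locales auto
      show "\<bar>E2 k S x\<bar> \<le> C * x powr (2 - 2 * real k / (real (card S) + real k) + \<epsilon>)"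
        unfolding C_def using S \<epsilon> x C1(1) C2 C3 C1'
        by (intro E2_bound_large_card) (auto simp: K_def)
    qed
  qed
qed

end
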